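(* Let $\mathbb{C}[X]$ be a $*$-algebra defined by `matrix relations' among $n\times n$ matrices of generators $P_i$, $i=1,\dots,r$. Its quantisation $\mathbb{C}_F[X]$ by cocycle cotwist using the cocycle $F$ determined by $\theta$ is the free associative algebra with matrices of generators $\hat P_i$ modulo the commutation relations \[ \hat P_i{}^\mu_\nu\bullet\hat P_j{}^\alpha_\beta=e^{2\imath(\theta^-_{\mu\alpha}-\theta^-_{\nu\alpha}+\theta^-_{\nu\beta}-\theta^-_{\mu\beta})}\,\hat P_j{}^\alpha_\beta\bullet\hat P_i{}^\mu_\nu \] (for all $i,j\in\{1,\dots,r\}$ and all $\mu,\nu,\alpha,\beta\in\{1,\dots,n\}$, no summation) and the matrix relations of $\mathbb{C}[X]$ with $P_i$ replaced by $\hat P_i$ (matrix products being taken with respect to $\bullet$).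
   Context: A commutative $*$-algebra $\mathbb{C}[X]$ is defined by `matrix relations' if it is generated by the entries $P_i{}^\mu_\nu$ of $n\times n$ matrices $P_1,\dots,P_r$ (corresponding to a real manifold $X\subset M_n(\mathbb{C})^r$), with relations (besides commutativity) expressed using only the operations of (a) matrix product, (b) trace, (c) Hermitian conjugation $(\ )^\dagger$, where $(P^\dagger)^\mu_\nu=(P^\nu_\mu)^*$; where $P_i^\dagger$ is specified this defines the $*$-operation on the generators. The left $\mathbb{C}[\mathrm{SU}_n]$-coaction is $P_i{}^\mu_\nu\mapsto a^\mu_aSa^c_\nu\otimes P_i{}^a_c$. Let $H=\mathbb{C}[\mathrm{S}(\mathrm{U}(1)^n)]=\mathbb{C}[t_\mu^{\pm1};\ \mu=1,\dots,n]/\langle t_1\cdots t_n=1\rangle$, $t_\mu^*=t_\mu^{-1}$, $t_\mu$ group-like, with Hopf $*$-algebra surjection $\pi:\mathbb{C}[\mathrm{SU}_n]\to H$, $\pi(a^\mu_\nu)=\delta^\mu_\nu t_\mu$. Let $\theta\in M_n(\mathbb{C})$ be a matrix all of whose rows and columns sum to zero, with $\theta^\dagger=-\theta$. With $t^{\vec a}=t_1^{a_1}\cdots t_n^{a_n}$, the formula $F(t^{\vec a},t^{\vec b})=e^{\imath\vec a\cdot\theta\cdot\vec b}$ defines a 2-cocycle on $H$, pulled back to $\mathbb{C}[\mathrm{SU}_n]$ via $\pi$. Put $\theta^-_{\mu\nu}=\frac12(\theta_{\mu\nu}-\theta_{\nu\mu})$. $\mathbb{C}_F[X]$ is the same vector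 space as $\mathbb{C}[X]$ with the same $*$-operation and product $f\bullet g=F(f_{(1)},g_{(1)})f_{(2)}g_{(2)}$, where $f\mapsto f_{(1)}\otimes f_{(2)}$ is the left coaction; equivalently, via $\pi$, $P_i{}^\mu_\nu$ is homogeneous of weight $t_\mu t_\nu^{-1}$ and $f\bullet g=F(\mathrm{wt} f,\mathrm{wt} g)fg$ on homogeneous elements. The generators are \[ \hat P_i{}^\mu_\nu=e^{-\imath\theta_{\mu\nu}+\frac{\imath}{2}(\theta_{\mu\mu}+\theta_{\nu\nu})}P_i{}^\mu_\nu . \] *)

theory Defs
  imports
    "HOL-Analysis.Finite_Cartesian_Product"
    "HOL-Library.Poly_Mapping"
    "HOL-Algebra.QuotRing"
    Complex_Main
begin

section \<open>The free \<open>*\<close>-algebra on the matrix entries\<close>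

text \<open>
  \<open>Entry i \<mu> \<nu>\<close> stands for the generator in row \<open>\<mu>\<close> and column \<open>\<nu>\<close> of the \<open>i\<close>-th matrix, and
  \<open>EntryStar i \<mu> \<nu>\<close> for its formal adjoint.  The index sets \<open>{1..r}\<close> and \<open>{1..n}\<close> are rendered by
  finite types.  Lists form a monoid under concatenation, so that finitely supported functions
  on lists with the convolution product are the free associative algebra.
\<close>

datatype ('r, 'n) letter = Entry 'r 'n 'n | EntryStar 'r 'n 'n

instantiation list :: (type) monoid_add
begin

definition zero_list :: "'a list" where "zero_list = []"

definition plus_list :: "'a list \<Rightarrow> 'a list \<Rightarrow> 'a list" where "plus_list xs ys = xs @ ys"

instance by standard (simp_all add: zero_list_def plus_list_def)

end

type_synonym ('r, 'n) free_alg = "('r, 'n) letter list \<Rightarrow>\<^sub>0 complex"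

definition var :: "('r, 'n) letter \<Rightarrow> ('r, 'n) free_alg" where
  "var x = Poly_Mapping.single [x] 1"

definition scalar :: "complex \<Rightarrow> ('r, 'n) free_alg" where
  "scalar c = Poly_Mapping.single [] c"

primrec letter_star :: "('r, 'n) letter \<Rightarrow> ('r, 'n) letter" where
  "letter_star (Entry i \<mu> \<nu>) = EntryStar i \<mu> \<nu>"
| "letter_star (EntryStar i \<mu> \<nu>) = Entry i \<mu> \<nu>"

text \<open>The antilinear, product-reversing involution extending \<^const>\<open>letter_star\<close>.\<close>

definition star :: "('r, 'n) free_alg \<Rightarrow> ('r, 'n) free_alg" where
  "star f = (\<Sum>u\<in>Poly_Mapping.keys f.
      Poly_Mapping.single (rev (map letter_star u)) (cnj (Poly_Mapping.lookup f u)))"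

definition free_ring :: "('r, 'n) free_alg ring" where
  "free_ring = \<lparr>carrier = UNIV, mult = (*), one = 1, zero = 0, add = (+)\<rparr>"

text \<open>The two-sided \<open>*\<close>-ideal generated by a set.\<close>

definition star_ideal :: "('r, 'n) free_alg set \<Rightarrow> ('r, 'n) free_alg set" where
  "star_ideal S = Idl\<^bsub>free_ring\<^esub> (S \<union> star ` S)"

text \<open>
  The map on cosets of \<open>I\<close> induced by a map \<open>h\<close> of the free algebra (compare \<^const>\<open>rcoset_mult\<close>);
  its value is a coset of \<open>I\<close> whenever \<open>h\<close> is additive and preserves \<open>I\<close>.
\<close>

definition induced ::
  "('r, 'n) free_alg set \<Rightarrow> (('r, 'n) free_alg \<Rightarrow> ('r, 'n) free_alg)
    \<Rightarrow> ('r, 'n) free_alg set \<Rightarrow> ('r, 'n) free_alg set" where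
  "induced I h A = (\<Union>a\<in>A. I +>\<^bsub>free_ring\<^esub> h a)"

abbreviation quot_star where "quot_star I \<equiv> induced I star"

abbreviation quot_scale where "quot_scale I c \<equiv> induced I ((*) (scalar c))"


section \<open>Matrix relations\<close>

text \<open>
  Matrix-valued and scalar-valued expressions formed with linear combinations, matrix product,
  trace and Hermitian conjugation; \<open>One\<close> is the identity matrix (the empty matrix product).
\<close>

datatype 'r mat_exp =
    Gen 'r
  | One
  | Plus "'r mat_exp" "'r mat_exp"
  | Scale "'r scal_exp" "'r mat_exp"
  | Prod "'r mat_exp" "'r mat_exp"
  | Dagger "'r mat_exp"
and 'r scal_exp =
    Const complex
  | Trace "'r mat_exp"
  | SPlus "'r scal_exp" "'r scal_exp"
  | SProd "'r scal_exp" "'r scal_exp"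

text \<open>
  Evaluation in the free \<open>*\<close>-algebra: \<open>mat_eval A \<mu> \<nu>\<close> is the entry of \<open>A\<close> in row \<open>\<mu>\<close> and column \<open>\<nu>\<close>.
\<close>

primrec mat_eval :: "'r mat_exp \<Rightarrow> 'n::finite \<Rightarrow> 'n \<Rightarrow> ('r, 'n) free_alg"
  and scal_eval :: "'r scal_exp \<Rightarrow> ('r, 'n::finite) free_alg" where
  "mat_eval (Gen i) = (\<lambda>\<mu> \<nu>. var (Entry i \<mu> \<nu>))"
| "mat_eval One = (\<lambda>\<mu> \<nu>. if \<mu> = \<nu> then 1 else 0)"
| "mat_eval (Plus A B) = (\<lambda>\<mu> \<nu>. mat_eval A \<mu> \<nu> + mat_eval B \<mu> \<nu>)"
| "mat_eval (Scale s A) = (\<lambda>\<mu> \<nu>. scal_eval s * mat_eval A \<mu> \<nu>)"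
| "mat_eval (Prod A B) = (\<lambda>\<mu> \<nu>. \<Sum>\<kappa>\<in>UNIV. mat_eval A \<mu> \<kappa> * mat_eval B \<kappa> \<nu>)"
| "mat_eval (Dagger A) = (\<lambda>\<mu> \<nu>. star (mat_eval A \<nu> \<mu>))"
| "scal_eval (Const c) = scalar c"
| "scal_eval (Trace A) = (\<Sum>\<mu>\<in>UNIV. mat_eval A \<mu> \<mu>)"
| "scal_eval (SPlus s t) = scal_eval s + scal_eval t"
| "scal_eval (SProd s t) = scal_eval s * scal_eval t"

datatype 'r mat_rel = MatEq "'r mat_exp" "'r mat_exp" | ScalEq "'r scal_exp" "'r scal_exp"

definition rel_elems :: "'r mat_rel set \<Rightarrow> ('r, 'n::finite) free_alg set" where
  "rel_elems R =
     {mat_eval A \<mu> \<nu> - mat_eval B \<mu> \<nu> | A B \<mu> \<nu>. MatEq A B \<in> R} \<union>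
     {scal_eval s - scal_eval t | s t. ScalEq s t \<in> R}"

primrec mat_dagger_free :: "'r mat_exp \<Rightarrow> bool"
  and scal_dagger_free :: "'r scal_exp \<Rightarrow> bool" where
  "mat_dagger_free (Gen i) = True"
| "mat_dagger_free One = True"
| "mat_dagger_free (Plus A B) = (mat_dagger_free A \<and> mat_dagger_free B)"
| "mat_dagger_free (Scale s A) = (scal_dagger_free s \<and> mat_dagger_free A)"
| "mat_dagger_free (Prod A B) = (mat_dagger_free A \<and> mat_dagger_free B)"
| "mat_dagger_free (Dagger A) = False"
| "scal_dagger_free (Const c) = True"
| "scal_dagger_free (Trace A) = mat_dagger_free A"
| "scal_dagger_free (SPlus s t) = (scal_dagger_free s \<and> scal_dagger_free t)"
| "scal_dagger_free (SProd s t) = (scal_dagger_free s \<and> scal_dagger_free t)"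

definition dagger_specified :: "'r mat_rel set \<Rightarrow> 'r \<Rightarrow> bool" where
  "dagger_specified R i \<longleftrightarrow> (\<exists>E. mat_dagger_free E \<and> MatEq (Dagger (Gen i)) E \<in> R)"

text \<open>
  If the relations specify the adjoint of every \<open>P\<^sub>i\<close> (thereby defining the \<open>*\<close>-operation on the
  generators), these are exactly the matrices \<open>P\<^sub>i\<close>.  A \<open>P\<^sub>i\<close> without such a specification
  contributes \<open>P\<^sub>i\<^sup>\<dagger>\<close> as a further matrix of generators, since the entries of the \<open>P\<^sub>i\<close> alone then
  need not generate a \<open>*\<close>-algebra.
\<close>

definition gen_matrices :: "'r mat_rel set \<Rightarrow> 'r mat_exp set" where
  "gen_matrices R = range Gen \<union> {Dagger (Gen i) | i. \<not> dagger_specified R i}"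


section \<open>The commutative algebra of the matrix relations\<close>

definition coord_ideal :: "'r mat_rel set \<Rightarrow> ('r, 'n::finite) free_alg set" where
  "coord_ideal R = star_ideal ({f * g - g * f | f g. True} \<union> rel_elems R)"

definition coord_alg :: "'r mat_rel set \<Rightarrow> ('r, 'n::finite) free_alg set ring" where
  "coord_alg R = free_ring Quot coord_ideal R"


section \<open>Weights and the cocycle\<close>

text \<open>
  The group of monomials \<open>t\<^sup>a = t\<^sub>1\<^sup>a\<^sup>1 \<dots> t\<^sub>n\<^sup>a\<^sup>n\<close> modulo \<open>t\<^sub>1 \<dots> t\<^sub>n = 1\<close>, written additively.  These
  group-like elements form a basis of the Hopf algebra of \<open>S(U(1)\<^sup>n)\<close>.
\<close>

definition monomial_rel :: "('n \<Rightarrow> int) \<Rightarrow> ('n \<Rightarrow> int) \<Rightarrow> bool" where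
  "monomial_rel a b \<longleftrightarrow> (\<exists>k. \<forall>\<mu>. a \<mu> = b \<mu> + k)"

lemma equivp_monomial_rel: "equivp monomial_rel"
proof (rule equivpI)
  show "reflp monomial_rel"
    by (rule reflpI) (auto simp: monomial_rel_def)
  show "symp monomial_rel"
  proof (rule sympI)
    fix a b :: "'n \<Rightarrow> int" assume "monomial_rel a b"
    then obtain k where "\<forall>\<mu>. a \<mu> = b \<mu> + k" by (auto simp: monomial_rel_def)
    then have "\<forall>\<mu>. b \<mu> = a \<mu> + (- k)" by simp
    then show "monomial_rel b a" unfolding monomial_rel_def by blast
  qed
  show "transp monomial_rel"
  proof (rule transpI)
    fix a b c :: "'n \<Rightarrow> int" assume "monomial_rel a b" "monomial_rel b c"
    then obtain k l where "\<forall>\<mu>. a \<mu> = b \<mu> + k" "\<forall>\<mu>. b \<mu> = c \<mu> + l"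
      by (auto simp: monomial_rel_def)
    then have "\<forall>\<mu>. a \<mu> = c \<mu> + (l + k)" by simp
    then show "monomial_rel a c" unfolding monomial_rel_def by blast
  qed
qed

quotient_type 'n weight = "'n \<Rightarrow> int" / monomial_rel
  by (rule equivp_monomial_rel)

instantiation weight :: (type) ab_group_add
begin

lift_definition zero_weight :: "'a weight" is "\<lambda>_. 0" .

lift_definition plus_weight :: "'a weight \<Rightarrow> 'a weight \<Rightarrow> 'a weight" is
  "\<lambda>(a :: 'a \<Rightarrow> int) (b :: 'a \<Rightarrow> int) \<mu>. a \<mu> + b \<mu>"
proof -
  fix a b c d :: "'a \<Rightarrow> int"
  assume "monomial_rel a b" "monomial_rel c d"
  then obtain k l where "\<forall>\<mu>. a \<mu> = b \<mu> + k" "\<forall>\<mu>. c \<mu> = d \<mu> + l"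
    by (auto simp: monomial_rel_def)
  then have "\<forall>\<mu>. a \<mu> + c \<mu> = b \<mu> + d \<mu> + (k + l)" by simp
  then show "monomial_rel (\<lambda>\<mu>. a \<mu> + c \<mu>) (\<lambda>\<mu>. b \<mu> + d \<mu>)" unfolding monomial_rel_def by blast
qed

lift_definition uminus_weight :: "'a weight \<Rightarrow> 'a weight" is "\<lambda>a \<mu>. - a \<mu>"
proof -
  fix a b :: "'a \<Rightarrow> int"
  assume "monomial_rel a b"
  then obtain k where "\<forall>\<mu>. a \<mu> = b \<mu> + k" by (auto simp: monomial_rel_def)
  then have "\<forall>\<mu>. - a \<mu> = - b \<mu> + (- k)" by simp
  then show "monomial_rel (\<lambda>\<mu>. - a \<mu>) (\<lambda>\<mu>. - b \<mu>)" unfolding monomial_rel_def by blast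
qed

definition minus_weight :: "'a weight \<Rightarrow> 'a weight \<Rightarrow> 'a weight" where
  "minus_weight a b = a + (- b)"

instance
proof
  fix a b c :: "'a weight"
  show "a + b + c = a + (b + c)"
    by transfer (simp add: add.assoc equivp_reflp[OF equivp_monomial_rel])
  show "a + b = b + a"
    by transfer (simp add: add.commute equivp_reflp[OF equivp_monomial_rel])
  show "0 + a = a"
    by transfer (simp add: equivp_reflp[OF equivp_monomial_rel])
  show "- a + a = 0"
    by transfer (simp add: equivp_reflp[OF equivp_monomial_rel])
  show "a - b = a + - b"
    by (rule minus_weight_def)
qed

end

lift_definition t_gen :: "'n \<Rightarrow> 'n weight" is "\<lambda>\<mu> \<nu>. if \<nu> = \<mu> then 1 else 0" .

text \<open>
  The value of the cocycle on group-like elements.  It is computed on representatives; the lemma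
  \<open>cocycle_abs\<close> below shows that the choice is immaterial when the rows and columns of \<open>\<theta>\<close> sum
  to zero.
\<close>

definition bilin :: "complex^'n^'n \<Rightarrow> ('n::finite \<Rightarrow> int) \<Rightarrow> ('n \<Rightarrow> int) \<Rightarrow> complex" where
  "bilin \<theta> a b = (\<Sum>\<mu>\<in>UNIV. \<Sum>\<nu>\<in>UNIV. of_int (a \<mu>) * \<theta> $ \<mu> $ \<nu> * of_int (b \<nu>))"

definition cocycle :: "complex^'n^'n \<Rightarrow> 'n::finite weight \<Rightarrow> 'n weight \<Rightarrow> complex" where
  "cocycle \<theta> v w = exp (\<i> * bilin \<theta> (rep_weight v) (rep_weight w))"

lemma cocycle_abs:
  fixes \<theta> :: "complex^'n^'n"
  assumes rows: "\<And>\<mu>. (\<Sum>\<nu>\<in>UNIV. \<theta> $ \<mu> $ \<nu>) = 0"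
    and cols: "\<And>\<nu>. (\<Sum>\<mu>\<in>UNIV. \<theta> $ \<mu> $ \<nu>) = 0"
  shows "cocycle \<theta> (abs_weight a) (abs_weight b) = exp (\<i> * bilin \<theta> a b)"
proof -
  have rep: "\<exists>k. \<forall>\<mu>. rep_weight (abs_weight c) \<mu> = c \<mu> + k" for c :: "'n \<Rightarrow> int"
    using rep_abs_rsp[OF Quotient3_weight, of c c] equivp_reflp[OF equivp_monomial_rel, of c]
      equivp_symp[OF equivp_monomial_rel]
    by (metis monomial_rel_def)
  obtain k where k: "\<And>\<mu>. rep_weight (abs_weight a) \<mu> = a \<mu> + k" using rep by blast
  obtain l where l: "\<And>\<mu>. rep_weight (abs_weight b) \<mu> = b \<mu> + l" using rep by blast
  have left: "bilin \<theta> (\<lambda>\<mu>. c \<mu> + k) d = bilin \<theta> c d" for c d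
  proof -
    have "bilin \<theta> (\<lambda>\<mu>. c \<mu> + k) d = bilin \<theta> c d
        + (\<Sum>\<mu>\<in>UNIV. \<Sum>\<nu>\<in>UNIV. of_int k * \<theta> $ \<mu> $ \<nu> * of_int (d \<nu>))"
      by (simp add: bilin_def algebra_simps sum.distrib)
    also have "(\<Sum>\<mu>\<in>UNIV. \<Sum>\<nu>\<in>UNIV. of_int k * \<theta> $ \<mu> $ \<nu> * of_int (d \<nu>))
        = (\<Sum>\<nu>\<in>UNIV. of_int k * (\<Sum>\<mu>\<in>UNIV. \<theta> $ \<mu> $ \<nu>) * of_int (d \<nu>))"
      by (subst sum.swap) (simp add: sum_distrib_left sum_distrib_right)
    finally show ?thesis by (simp add: cols)
  qed
  have right: "bilin \<theta> c (\<lambda>\<mu>. d \<mu> + l) = bilin \<theta> c d" for c d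
  proof -
    have "bilin \<theta> c (\<lambda>\<mu>. d \<mu> + l) = bilin \<theta> c d
        + (\<Sum>\<mu>\<in>UNIV. \<Sum>\<nu>\<in>UNIV. of_int (c \<mu>) * \<theta> $ \<mu> $ \<nu> * of_int l)"
      by (simp add: bilin_def algebra_simps sum.distrib)
    also have "(\<Sum>\<mu>\<in>UNIV. \<Sum>\<nu>\<in>UNIV. of_int (c \<mu>) * \<theta> $ \<mu> $ \<nu> * of_int l)
        = (\<Sum>\<mu>\<in>UNIV. of_int (c \<mu>) * (\<Sum>\<nu>\<in>UNIV. \<theta> $ \<mu> $ \<nu>) * of_int l)"
      by (simp add: sum_distrib_left sum_distrib_right)
    finally show ?thesis by (simp add: rows)
  qed
  have "rep_weight (abs_weight a) = (\<lambda>\<mu>. a \<mu> + k)" "rep_weight (abs_weight b) = (\<lambda>\<mu>. b \<mu> + l)"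
    using k l by auto
  then show ?thesis by (simp add: cocycle_def left right)
qed

text \<open>
  Pushing the coaction \<open>P\<^sub>i \<mapsto> a P\<^sub>i S(a)\<close> of the coordinate algebra of \<open>SU(n)\<close> forward along \<open>\<pi>\<close>
  gives the entry \<open>(\<mu>,\<nu>)\<close> of \<open>P\<^sub>i\<close> the weight \<open>t\<^sub>\<mu> t\<^sub>\<nu>\<^sup>-\<^sup>1\<close>; as the coaction is a \<open>*\<close>-map and
  \<open>t\<^sub>\<mu>\<^sup>* = t\<^sub>\<mu>\<^sup>-\<^sup>1\<close>, adjoints have the inverse weight.
\<close>

primrec letter_weight :: "('r, 'n) letter \<Rightarrow> 'n weight" where
  "letter_weight (Entry i \<mu> \<nu>) = t_gen \<mu> - t_gen \<nu>"
| "letter_weight (EntryStar i \<mu> \<nu>) = t_gen \<nu> - t_gen \<mu>"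

definition word_weight :: "('r, 'n) letter list \<Rightarrow> 'n weight" where
  "word_weight u = sum_list (map letter_weight u)"

definition component :: "'n weight \<Rightarrow> ('r, 'n) free_alg \<Rightarrow> ('r, 'n) free_alg" where
  "component w f = (\<Sum>u\<in>{u \<in> Poly_Mapping.keys f. word_weight u = w}.
      Poly_Mapping.single u (Poly_Mapping.lookup f u))"

abbreviation quot_component where "quot_component I w \<equiv> induced I (component w)"


section \<open>The cocycle cotwist\<close>

text \<open>
  On the quotient algebra the coaction is \<open>f \<mapsto> \<Sum>\<^sub>w t\<^sup>w \<otimes> f\<^sub>w\<close> with \<open>f\<^sub>w\<close> the component of weight \<open>w\<close>, so
  that \<open>F(f\<^sub>(\<^sub>1\<^sub>), g\<^sub>(\<^sub>1\<^sub>)) f\<^sub>(\<^sub>2\<^sub>) g\<^sub>(\<^sub>2\<^sub>)\<close> is the following finite sum.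
\<close>

definition support :: "'r mat_rel set \<Rightarrow> ('r, 'n::finite) free_alg set \<Rightarrow> 'n weight set" where
  "support R A = {w. quot_component (coord_ideal R) w A \<noteq> \<zero>\<^bsub>coord_alg R\<^esub>}"

definition twisted_mult ::
  "complex^'n^'n \<Rightarrow> 'r mat_rel set
    \<Rightarrow> ('r, 'n::finite) free_alg set \<Rightarrow> ('r, 'n) free_alg set \<Rightarrow> ('r, 'n) free_alg set" where
  "twisted_mult \<theta> R A B =
    finsum (coord_alg R)
      (\<lambda>(v, w). quot_scale (coord_ideal R) (cocycle \<theta> v w)
         (quot_component (coord_ideal R) v A \<otimes>\<^bsub>coord_alg R\<^esub> quot_component (coord_ideal R) w B))
      (support R A \<times> support R B)"

definition cotwist_alg ::
  "complex^'n^'n \<Rightarrow> 'r mat_rel set \<Rightarrow> ('r, 'n::finite) free_alg set ring" where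
  "cotwist_alg \<theta> R = (coord_alg R) \<lparr>mult := twisted_mult \<theta> R\<rparr>"

definition hat_phase :: "complex^'n^'n \<Rightarrow> 'n \<Rightarrow> 'n \<Rightarrow> complex" where
  "hat_phase \<theta> \<mu> \<nu> =
     exp (- \<i> * \<theta> $ \<mu> $ \<nu> + \<i> / 2 * (\<theta> $ \<mu> $ \<mu> + \<theta> $ \<nu> $ \<nu>))"

definition hat_gen ::
  "complex^'n^'n \<Rightarrow> 'r mat_rel set \<Rightarrow> 'r \<Rightarrow> 'n::finite \<Rightarrow> 'n \<Rightarrow> ('r, 'n) free_alg set" where
  "hat_gen \<theta> R i \<mu> \<nu> =
     quot_scale (coord_ideal R) (hat_phase \<theta> \<mu> \<nu>)
       (coord_ideal R +>\<^bsub>free_ring\<^esub> var (Entry i \<mu> \<nu>))"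


section \<open>The quantised presentation\<close>

definition theta_minus :: "complex^'n^'n \<Rightarrow> 'n \<Rightarrow> 'n \<Rightarrow> complex" where
  "theta_minus \<theta> \<mu> \<nu> = (\<theta> $ \<mu> $ \<nu> - \<theta> $ \<nu> $ \<mu>) / 2"

definition commutation_elems ::
  "complex^'n^'n \<Rightarrow> 'r mat_rel set \<Rightarrow> ('r, 'n::finite) free_alg set" where
  "commutation_elems \<theta> R =
     {mat_eval A \<mu> \<nu> * mat_eval B \<alpha> \<beta>
        - scalar (exp (2 * \<i> * (theta_minus \<theta> \<mu> \<alpha> - theta_minus \<theta> \<nu> \<alpha>
                                + theta_minus \<theta> \<nu> \<beta> - theta_minus \<theta> \<mu> \<beta>)))
          * (mat_eval B \<alpha> \<beta> * mat_eval A \<mu> \<nu>)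
      | A B \<mu> \<nu> \<alpha> \<beta>. A \<in> gen_matrices R \<and> B \<in> gen_matrices R}"

definition quantum_ideal ::
  "complex^'n^'n \<Rightarrow> 'r mat_rel set \<Rightarrow> ('r, 'n::finite) free_alg set" where
  "quantum_ideal \<theta> R = star_ideal (commutation_elems \<theta> R \<union> rel_elems R)"

definition quantum_alg ::
  "complex^'n^'n \<Rightarrow> 'r mat_rel set \<Rightarrow> ('r, 'n::finite) free_alg set ring" where
  "quantum_alg \<theta> R = free_ring Quot quantum_ideal \<theta> R"

end

theory Submission
  imports Defs
begin

text \<open>
  On the free algebra let \<open>T\<close> multiply each word by the phase that its letters, replaced by the
  generators with a hat, acquire in the cotwisted product.  \<open>T\<close> is a linear bijection compatible
  with \<open>*\<close>, and it carries the product of homogeneous elements to the cocycle multiple of their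
  product.  Hence preimages of weight-graded ideals under \<open>T\<close> and its inverse are ideals.  Every
  entry of a matrix expression is an eigenvector of \<open>T\<close>, so that \<open>T\<close> preserves the matrix relations
  up to scalars, and it turns the quantum commutators into multiples of the classical ones.
  Therefore \<open>T\<close> maps the quantum ideal onto the classical one, and the isomorphism is the map
  induced on cosets.
\<close>

section \<open>Diagonal maps of the free algebra\<close>

text \<open>The substance of the claim is completeness: the cotwisted algebra satisfies no relations
  beyond the listed ones. A linear bijection of the whole free algebra turns this into an equality
  of two ideals, so no basis or dimension count is required. The hypotheses on \<theta> enter
  through the cocycle \<open>F\<close>. Vanishing row and column sums make \<open>F\<close> a
  well-defined bicharacter on weights, so the phase of a word does not depend on bracketing.
  Anti-Hermiticity gives that the conjugate of \<open>F(v,w)\<close> is \<open>F(w,v)\<close>, which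
  matches the reversal of products by the involution. The two inclusions are not symmetric. The
  classical ideal contains the commutators of all pairs of elements, whereas the quantum relations
  concern only entries of the generating matrices. The missing commutators have to be derived, and
  for adjoints that are specified by the relations this uses the matrix relations
  themselves.\<close>

lemma free_alg_induct [case_names single add]:
  fixes f :: "('r, 'n) free_alg"
  assumes single: "\<And>u c. P (Poly_Mapping.single u c)"
    and add: "\<And>f g. P f \<Longrightarrow> P g \<Longrightarrow> P (f + g)"
  shows "P f"
proof (induction f rule: update_induct)
  case const
  \<comment> \<open>Zero is a monomial with coefficient 0, on whatever word.\<close>
  then show ?case using single[of undefined 0] by simp
next
  case (update f a b)
  have "Poly_Mapping.update a b f = f + Poly_Mapping.single a b"
    using update(1) by (intro poly_mapping_eqI)
      (auto simp: lookup_update lookup_add lookup_single when_def in_keys_iff)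
  then show ?case using add update.IH single by simp
qed

text \<open>A common form for operators that are diagonal in the basis of words: the twist, its
  inverse, the weight projections and multiplication by scalars. They therefore all commute with one
  another.\<close>

definition rescale :: "(('r, 'n) letter list \<Rightarrow> complex) \<Rightarrow> ('r, 'n) free_alg \<Rightarrow> ('r, 'n) free_alg"
  where "rescale c f = Poly_Mapping.mapp (\<lambda>u x. c u * x) f"

lemma lookup_rescale [simp]: "Poly_Mapping.lookup (rescale c f) u = c u * Poly_Mapping.lookup f u"
  by (simp add: rescale_def lookup_mapp when_def in_keys_iff)

lemma rescale_single [simp]: "rescale c (Poly_Mapping.single u x) = Poly_Mapping.single u (c u * x)"
  by (intro poly_mapping_eqI) (simp add: lookup_single when_def)

lemma rescale_add: "rescale c (f + g) = rescale c f + rescale c g"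
  by (intro poly_mapping_eqI) (simp add: lookup_add algebra_simps)

lemma rescale_diff: "rescale c (f - g) = rescale c f - rescale c g"
  by (intro poly_mapping_eqI) (simp add: lookup_minus algebra_simps)

lemma rescale_zero [simp]: "rescale c 0 = 0"
  by (intro poly_mapping_eqI) simp

lemma rescale_sum: "rescale c (sum f A) = (\<Sum>x\<in>A. rescale c (f x))"
  by (induction A rule: infinite_finite_induct) (simp_all add: rescale_add)

lemma rescale_commute: "rescale c (rescale d f) = rescale d (rescale c f)"
  by (intro poly_mapping_eqI) simp

lemma rescale_inverse:
  assumes "\<And>u. c u \<noteq> 0"
  shows "rescale c (rescale (\<lambda>u. inverse (c u)) f) = f"
    and "rescale (\<lambda>u. inverse (c u)) (rescale c f) = f"
  using assms by (auto intro!: poly_mapping_eqI)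

lemma bij_rescale:
  assumes "\<And>u. c u \<noteq> 0"
  shows "bij (rescale c)"
  using assms by (intro o_bij[of "rescale (\<lambda>u. inverse (c u))"] ext)
    (simp_all add: rescale_inverse[of c])

section \<open>Products of monomials and central scalars\<close>

lemma single_mult_single:
  fixes u v :: "'a list" and a b :: complex
  shows "Poly_Mapping.single u a * Poly_Mapping.single v b = Poly_Mapping.single (u @ v) (a * b)"
  by (simp add: mult_single plus_list_def)

lemma one_free_alg: "(1 :: ('r, 'n) free_alg) = Poly_Mapping.single [] 1"
  by (metis single_one zero_list_def)

lemma scalar_mult_eq_rescale: "scalar c * f = rescale (\<lambda>_. c) f"
  by (induction f rule: free_alg_induct)
    (simp_all add: scalar_def single_mult_single rescale_add distrib_left)

lemma mult_scalar_eq_rescale: "f * scalar c = rescale (\<lambda>_. c) f"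
  by (induction f rule: free_alg_induct)
    (simp_all add: scalar_def single_mult_single rescale_add distrib_right mult.commute)

lemma scalar_central: "scalar c * f = f * scalar c"
  by (simp only: scalar_mult_eq_rescale mult_scalar_eq_rescale)

lemma scalar_mult_scalar: "scalar c * scalar d = scalar (c * d)"
  by (simp add: scalar_def single_mult_single)

lemma scalar_one [simp]: "scalar 1 = 1"
  by (simp add: scalar_def one_free_alg)

lemma scalar_zero [simp]: "scalar 0 = 0"
  by (simp add: scalar_def)

lemma scalar_mult_scalar_mult: "scalar c * (scalar d * f) = scalar (c * d) * f"
  by (simp only: scalar_mult_scalar flip: mult.assoc)

lemma rescale_scalar_mult: "rescale c (scalar x * f) = scalar x * rescale c f"
  by (simp only: scalar_mult_eq_rescale rescale_commute[of c])

lemma scalar_mult_mult_scalar_mult: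
  "(scalar c * f) * (scalar d * g) = scalar (c * d) * (f * g)"
proof -
  have "(scalar c * f) * (scalar d * g) = scalar c * (f * scalar d) * g"
    by (simp only: mult.assoc)
  also have "\<dots> = scalar c * scalar d * (f * g)"
    by (simp only: mult.assoc flip: scalar_central[of d f])
  finally show ?thesis by (simp only: scalar_mult_scalar)
qed


section \<open>The involution\<close>

lemma letter_star_letter_star [simp]: "letter_star (letter_star x) = x"
  by (cases x) auto

definition word_star :: "('r, 'n) letter list \<Rightarrow> ('r, 'n) letter list" where
  "word_star u = rev (map letter_star u)"

lemma word_star_word_star [simp]: "word_star (word_star u) = u"
  by (simp add: word_star_def rev_map comp_def)

lemma word_star_append: "word_star (u @ v) = word_star v @ word_star u"
  by (simp add: word_star_def)

text \<open>\<open>word_star\<close> is an involution, so exactly one word contributes to each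
  coefficient.\<close>

lemma lookup_star [simp]:
  "Poly_Mapping.lookup (star f) u = cnj (Poly_Mapping.lookup f (word_star u))"
proof -
  have "Poly_Mapping.lookup (star f) u = (\<Sum>v\<in>Poly_Mapping.keys f.
      if v = word_star u then cnj (Poly_Mapping.lookup f v) else 0)"
    unfolding star_def lookup_sum
    by (intro sum.cong refl)
      (auto simp: lookup_single when_def simp flip: word_star_def)
  then show ?thesis by (simp add: sum.delta in_keys_iff)
qed

lemma star_add: "star (f + g) = star f + star g"
  by (intro poly_mapping_eqI) (simp add: lookup_add)

lemma star_star [simp]: "star (star f) = f"
  by (intro poly_mapping_eqI) simp

lemma star_single [simp]:
  "star (Poly_Mapping.single u c) = Poly_Mapping.single (word_star u) (cnj c)"
  by (intro poly_mapping_eqI) (auto simp: lookup_single when_def)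

lemma star_mult: "star (f * g) = star g * star f"
proof (induction f rule: free_alg_induct)
  case (single u c)
  show ?case
    by (induction g rule: free_alg_induct)
      (simp_all add: single_mult_single word_star_append star_add distrib_left distrib_right
        mult.commute)
qed (simp add: star_add distrib_left distrib_right)

lemma star_scalar [simp]: "star (scalar c) = scalar (cnj c)"
  by (simp add: scalar_def word_star_def)

lemma star_scalar_mult: "star (scalar c * f) = scalar (cnj c) * star f"
  by (simp add: star_mult flip: scalar_central)

lemma star_var [simp]: "star (var x) = var (letter_star x)"
  by (simp add: var_def word_star_def)

text \<open>Reduces compatibility of a diagonal map with \<open>star\<close> to a condition on its
  factors: \<open>c\<close> at the starred word must be the conjugate of \<open>c\<close>.\<close>

lemma star_rescale: "star (rescale c f) = rescale (\<lambda>u. cnj (c (word_star u))) (star f)"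
  by (intro poly_mapping_eqI) simp


section \<open>Ideals of the free algebra\<close>

lemma free_ring_simps [simp]:
  "carrier free_ring = UNIV" "mult free_ring = (*)" "one free_ring = 1"
  "zero free_ring = 0" "add free_ring = (+)"
  by (simp_all add: free_ring_def)

lemma ring_free_ring: "ring (free_ring :: ('r, 'n) free_alg ring)"
proof (rule ringI)
  show "abelian_group (free_ring :: ('r, 'n) free_alg ring)"
  proof (rule abelian_groupI)
    fix f :: "('r, 'n) free_alg"
    have "- f + f = 0" by simp
    then show "\<exists>g\<in>carrier free_ring. g \<oplus>\<^bsub>free_ring\<^esub> f = \<zero>\<^bsub>free_ring\<^esub>"
      unfolding free_ring_simps by blast
  qed (simp_all add: ac_simps)
  show "Group.monoid (free_ring :: ('r, 'n) free_alg ring)"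
    by (rule monoidI) (auto simp: mult.assoc)
qed (auto simp: algebra_simps)

lemma ideal_free_ringI:
  fixes I :: "('r, 'n) free_alg set"
  assumes "0 \<in> I" and "\<And>f g. f \<in> I \<Longrightarrow> g \<in> I \<Longrightarrow> f + g \<in> I"
    and l: "\<And>f g. f \<in> I \<Longrightarrow> g * f \<in> I" and "\<And>f g. f \<in> I \<Longrightarrow> f * g \<in> I"
  shows "ideal I free_ring"
proof (rule idealI[OF ring_free_ring])
  interpret ring "free_ring :: ('r, 'n) free_alg ring" by (rule ring_free_ring)
  have inv: "\<ominus>\<^bsub>free_ring\<^esub> f = - f" for f :: "('r, 'n) free_alg"
    by (intro minus_equality) auto
  show "subgroup I (add_monoid free_ring)"
  proof (rule add.subgroupI)
    fix f assume "f \<in> I"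
    then show "\<ominus>\<^bsub>free_ring\<^esub> f \<in> I" using l[of f "- 1"] by (simp add: inv)
  qed (use assms(1,2) in auto)
qed (use assms in auto)

lemma
  fixes I :: "('r, 'n) free_alg set"
  assumes "ideal I free_ring"
  shows ideal_zero: "0 \<in> I"
    and ideal_add: "f \<in> I \<Longrightarrow> g \<in> I \<Longrightarrow> f + g \<in> I"
    and ideal_mult_left: "f \<in> I \<Longrightarrow> g * f \<in> I"
    and ideal_mult_right: "f \<in> I \<Longrightarrow> f * g \<in> I"
    and ideal_diff: "f \<in> I \<Longrightarrow> g \<in> I \<Longrightarrow> f - g \<in> I"
proof -
  interpret ideal I free_ring by fact
  show "0 \<in> I" using additive_subgroup.zero_closed[OF additive_subgroup_axioms] by simp
  show add: "f + g \<in> I" if "f \<in> I" "g \<in> I" for f g 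
    using additive_subgroup.a_closed[OF additive_subgroup_axioms that] by simp
  show l: "g * f \<in> I" if "f \<in> I" for f g using I_l_closed that by simp
  show "f * g \<in> I" if "f \<in> I" using I_r_closed that by simp
  show "f - g \<in> I" if "f \<in> I" "g \<in> I" using add[OF that(1) l[OF that(2), of "- 1"]] by simp
qed

lemma ideal_sum:
  assumes "ideal I free_ring" and "\<And>x. x \<in> A \<Longrightarrow> f x \<in> I"
  shows "sum f A \<in> I"
  using assms(2) by (induction A rule: infinite_finite_induct)
    (auto simp: ideal_zero[OF assms(1)] ideal_add[OF assms(1)])

section \<open>Cosets and induced maps\<close>

lemma coset_free_ring: "I +>\<^bsub>free_ring\<^esub> a = (\<lambda>h. h + a) ` I"
  by (auto simp: a_r_coset_def')

lemma coset_eq_iff: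
  fixes I :: "('r, 'n) free_alg set"
  assumes "ideal I free_ring"
  shows "I +>\<^bsub>free_ring\<^esub> a = I +>\<^bsub>free_ring\<^esub> b \<longleftrightarrow> a - b \<in> I"
proof
  assume "I +>\<^bsub>free_ring\<^esub> a = I +>\<^bsub>free_ring\<^esub> b"
  moreover have "a \<in> I +>\<^bsub>free_ring\<^esub> a"
    using ideal_zero[OF assms] by (force simp: coset_free_ring)
  ultimately show "a - b \<in> I" by (auto simp: coset_free_ring)
next
  assume ab: "a - b \<in> I"
  have "h + a = (h + (a - b)) + b" "h + b = (h - (a - b)) + a" for h by simp_all
  then show "I +>\<^bsub>free_ring\<^esub> a = I +>\<^bsub>free_ring\<^esub> b"
    unfolding coset_free_ring using ideal_add[OF assms _ ab] ideal_diff[OF assms _ ab] by blast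
qed

text \<open>All representatives yield the same coset, so the union defining \<open>induced\<close>
  collapses to it; the union is not empty because \<open>I\<close> contains 0.\<close>

lemma induced_coset:
  fixes I :: "('r, 'n) free_alg set"
  assumes I: "ideal I free_ring" and add: "\<And>f g. h (f + g) = h f + h g"
    and pres: "\<And>f. f \<in> I \<Longrightarrow> h f \<in> I"
  shows "induced I h (I +>\<^bsub>free_ring\<^esub> a) = I +>\<^bsub>free_ring\<^esub> h a"
proof -
  have "I +>\<^bsub>free_ring\<^esub> h (g + a) = I +>\<^bsub>free_ring\<^esub> h a" if "g \<in> I" for g
    using that by (simp add: coset_eq_iff[OF I] add pres)
  moreover have "I \<noteq> {}" using ideal_zero[OF I] by blast
  ultimately show ?thesis by (simp add: induced_def coset_free_ring[of I a])
qed

text \<open>Monomials span the free algebra, so for an additive \<open>h\<close> closure under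
  multiplication can be tested on them; \<open>h\<close> may fail to be multiplicative.\<close>

lemma ideal_vimageI:
  fixes I :: "('r, 'n) free_alg set" and h :: "('r, 'n) free_alg \<Rightarrow> ('r, 'n) free_alg"
  assumes I: "ideal I free_ring" and add: "\<And>f g. h (f + g) = h f + h g"
    and "\<And>f u c. h f \<in> I \<Longrightarrow> h (Poly_Mapping.single u c * f) \<in> I"
    and "\<And>f u c. h f \<in> I \<Longrightarrow> h (f * Poly_Mapping.single u c) \<in> I"
  shows "ideal {f. h f \<in> I} free_ring"
proof (rule ideal_free_ringI)
  have "h 0 = 0" using add[of 0 0] by simp
  then show "0 \<in> {f. h f \<in> I}" by (simp add: ideal_zero[OF I])
  show "f + g \<in> {f. h f \<in> I}" if "f \<in> {f. h f \<in> I}" "g \<in> {f. h f \<in> I}" for f g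
    using that by (simp add: add ideal_add[OF I])
  fix f g assume f: "f \<in> {f. h f \<in> I}"
  show "g * f \<in> {f. h f \<in> I}"
    using f assms(3) by (induction g rule: free_alg_induct)
      (auto simp: distrib_right add ideal_add[OF I])
  show "f * g \<in> {f. h f \<in> I}"
    using f assms(4) by (induction g rule: free_alg_induct)
      (auto simp: distrib_left add ideal_add[OF I])
qed

section \<open>Ideals generated together with adjoints\<close>

lemma ideal_star_ideal: "ideal (star_ideal S) free_ring"
  unfolding star_ideal_def using ring.genideal_ideal[OF ring_free_ring] by auto

lemma star_ideal_superset: "S \<union> star ` S \<subseteq> star_ideal S"
  unfolding star_ideal_def using ring.genideal_self[OF ring_free_ring, of "S \<union> star ` S"] by simp

lemma star_ideal_generator: "s \<in> S \<Longrightarrow> s \<in> star_ideal S"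
  using star_ideal_superset by blast

lemma star_ideal_minimal:
  "ideal I free_ring \<Longrightarrow> S \<union> star ` S \<subseteq> I \<Longrightarrow> star_ideal S \<subseteq> I"
  unfolding star_ideal_def using ring.genideal_minimal[OF ring_free_ring] by blast

text \<open>\<open>star\<close> interchanges left and right multiples, so the preimage of a
  two-sided ideal is again one; the generating set is closed under \<open>star\<close>.\<close>

lemma star_in_star_ideal:
  assumes "f \<in> star_ideal S"
  shows "star f \<in> star_ideal S"
proof -
  note I = ideal_star_ideal[of S]
  have "ideal {f. star f \<in> star_ideal S} free_ring"
    by (rule ideal_vimageI[OF I])
      (auto simp: star_add star_mult ideal_mult_left[OF I] ideal_mult_right[OF I])
  then have "star_ideal S \<subseteq> {f. star f \<in> star_ideal S}"
    by (rule star_ideal_minimal) (use star_ideal_superset[of S] in auto)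
  then show ?thesis using assms by blast
qed


section \<open>Homogeneity\<close>

lemma word_weight_append: "word_weight (u @ v) = word_weight u + word_weight v"
  by (simp add: word_weight_def)

lemma word_weight_Nil [simp]: "word_weight [] = 0"
  by (simp add: word_weight_def)

lemma word_weight_Cons [simp]: "word_weight (x # u) = letter_weight x + word_weight u"
  by (simp add: word_weight_def)

lemma letter_weight_letter_star [simp]: "letter_weight (letter_star x) = - letter_weight x"
  by (cases x) auto

lemma word_weight_word_star [simp]: "word_weight (word_star u) = - word_weight u"
  by (induction u) (simp_all add: word_star_def word_weight_append)

lemma component_eq_rescale:
  "component w f = rescale (\<lambda>u. if word_weight u = w then 1 else 0) f"
proof -
  have "Poly_Mapping.lookup (component w f) u
      = (\<Sum>v\<in>{v \<in> Poly_Mapping.keys f. word_weight v = w}.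
          if v = u then Poly_Mapping.lookup f v else 0)" for u
    unfolding component_def lookup_sum
    by (intro sum.cong refl) (auto simp: lookup_single when_def)
  then show ?thesis
    by (intro poly_mapping_eqI) (simp add: sum.delta in_keys_iff)
qed

lemma component_single [simp]: "component w (Poly_Mapping.single u c) =
    (if word_weight u = w then Poly_Mapping.single u c else 0)"
  by (simp add: component_eq_rescale)

lemma component_zero [simp]: "component w 0 = 0"
  by (simp add: component_eq_rescale)

lemma component_add: "component w (f + g) = component w f + component w g"
  by (simp add: component_eq_rescale rescale_add)

lemma component_diff: "component w (f - g) = component w f - component w g"
  by (simp add: component_eq_rescale rescale_diff)

lemma component_scalar_mult: "component w (scalar c * f) = scalar c * component w f"
  by (simp add: component_eq_rescale rescale_scalar_mult)

lemma component_rescale: "component w (rescale c f) = rescale c (component w f)"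
  unfolding component_eq_rescale by (rule rescale_commute)

lemma component_component: "component v (component w f) = (if v = w then component w f else 0)"
  unfolding component_eq_rescale by (auto intro!: poly_mapping_eqI)

lemma component_star: "component w (star f) = star (component (- w) f)"
  unfolding component_eq_rescale
  by (intro poly_mapping_eqI) auto

lemma sum_component:
  assumes "finite W" "word_weight ` Poly_Mapping.keys f \<subseteq> W"
  shows "(\<Sum>w\<in>W. component w f) = f"
proof (rule poly_mapping_eqI)
  fix u
  have "Poly_Mapping.lookup (\<Sum>w\<in>W. component w f) u
      = (\<Sum>w\<in>W. if w = word_weight u then Poly_Mapping.lookup f u else 0)"
    unfolding lookup_sum by (intro sum.cong refl) (simp add: component_eq_rescale)
  also have "\<dots> = (if word_weight u \<in> W then Poly_Mapping.lookup f u else 0)"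
    using assms(1) by (rule sum.delta)
  also have "\<dots> = Poly_Mapping.lookup f u"
    using assms(2) by (cases "u \<in> Poly_Mapping.keys f") (auto simp: in_keys_iff)
  finally show "Poly_Mapping.lookup (\<Sum>w\<in>W. component w f) u = Poly_Mapping.lookup f u" .
qed

definition homogeneous :: "'n weight \<Rightarrow> ('r, 'n) free_alg \<Rightarrow> bool" where
  "homogeneous w f \<longleftrightarrow> component w f = f"

lemma component_homogeneous: "homogeneous w f \<Longrightarrow> component v f = (if v = w then f else 0)"
  using component_component[of v w f] by (auto simp: homogeneous_def split: if_splits)

lemma homogeneous_component [simp]: "homogeneous w (component w f)"
  by (simp add: homogeneous_def component_component)

lemma homogeneous_single: "homogeneous (word_weight u) (Poly_Mapping.single u c)"
  by (simp add: homogeneous_def)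

lemma component_single_mult:
  "component w (Poly_Mapping.single u c * f) = Poly_Mapping.single u c * component (w - word_weight u) f"
  by (induction f rule: free_alg_induct)
    (simp_all add: component_add distrib_left single_mult_single word_weight_append eq_diff_eq
      add.commute)

lemma component_mult_single:
  "component w (f * Poly_Mapping.single u c) = component (w - word_weight u) f * Poly_Mapping.single u c"
  by (induction f rule: free_alg_induct)
    (simp_all add: component_add distrib_right single_mult_single word_weight_append eq_diff_eq)

lemma homogeneous_mult:
  assumes "homogeneous v f" "homogeneous w g"
  shows "homogeneous (v + w) (f * g)"
proof -
  \<comment> \<open>Projections replace the homogeneity premises: they are additive in
    \<open>f\<close>, so the induction can split \<open>f\<close> arbitrarily.\<close>
  have "homogeneous (v + w) (component v f * component w g)"
  proof (induction f rule: free_alg_induct)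
    case (single u c)
    show ?case by (simp add: homogeneous_def component_single_mult component_component)
  next
    case (add f h)
    then show ?case by (simp only: homogeneous_def component_add distrib_right)
  qed
  then show ?thesis using assms by (simp add: homogeneous_def)
qed

definition graded :: "('r, 'n) free_alg set \<Rightarrow> bool" where
  "graded I \<longleftrightarrow> (\<forall>f\<in>I. \<forall>w. component w f \<in> I)"

text \<open>Multiplication by a word only shifts weights, so the elements with all components in the
  ideal form an ideal. Adjoints of generators are covered because \<open>star\<close> negates
  weights.\<close>

lemma graded_star_ideal:
  assumes "\<And>s w. s \<in> S \<Longrightarrow> component w s \<in> star_ideal S"
  shows "graded (star_ideal S)"
proof -
  note I = ideal_star_ideal[of S]
  have "star_ideal S \<subseteq> {f. \<forall>w. component w f \<in> star_ideal S}"
  proof (rule star_ideal_minimal)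
    show "ideal {f. \<forall>w. component w f \<in> star_ideal S} free_ring"
    proof (rule ideal_free_ringI)
      fix f g assume f: "f \<in> {f. \<forall>w. component w f \<in> star_ideal S}"
      show "g * f \<in> {f. \<forall>w. component w f \<in> star_ideal S}"
        using f by (induction g rule: free_alg_induct)
          (auto simp: distrib_right component_add component_single_mult ideal_add[OF I]
            ideal_mult_left[OF I])
      show "f * g \<in> {f. \<forall>w. component w f \<in> star_ideal S}"
        using f by (induction g rule: free_alg_induct)
          (auto simp: distrib_left component_add component_mult_single ideal_add[OF I]
            ideal_mult_right[OF I])
    qed (auto simp: component_add ideal_add[OF I] ideal_zero[OF I])
    have "component w (star s) \<in> star_ideal S" if "s \<in> S" for s w
      unfolding component_star by (intro star_in_star_ideal assms that)
    then show "S \<union> star ` S \<subseteq> {f. \<forall>w. component w f \<in> star_ideal S}"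
      using assms by auto
  qed
  then show ?thesis by (auto simp: graded_def)
qed

lemma homogeneous_add: "homogeneous w f \<Longrightarrow> homogeneous w g \<Longrightarrow> homogeneous w (f + g)"
  by (simp add: homogeneous_def component_add)

lemma homogeneous_diff: "homogeneous w f \<Longrightarrow> homogeneous w g \<Longrightarrow> homogeneous w (f - g)"
  by (simp add: homogeneous_def component_diff)

lemma homogeneous_scalar_mult: "homogeneous w f \<Longrightarrow> homogeneous w (scalar c * f)"
  by (simp add: homogeneous_def component_scalar_mult)

lemma homogeneous_zero [simp]: "homogeneous w 0"
  by (simp add: homogeneous_def)

lemma homogeneous_scalar: "homogeneous 0 (scalar c)"
  by (simp add: homogeneous_def scalar_def)

lemma homogeneous_one: "homogeneous 0 1"
  using homogeneous_scalar[of 1] by simp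

lemma homogeneous_var: "homogeneous (letter_weight x) (var x)"
  by (simp add: homogeneous_def var_def)

lemma homogeneous_sum: "(\<And>x. x \<in> A \<Longrightarrow> homogeneous w (f x)) \<Longrightarrow> homogeneous w (sum f A)"
  by (induction A rule: infinite_finite_induct) (auto intro: homogeneous_add)

lemma homogeneous_star: "homogeneous w f \<Longrightarrow> homogeneous (- w) (star f)"
  by (simp add: homogeneous_def component_star)

text \<open>Every word of \<open>f\<close> has weight \<open>v\<close> and every word of
  \<open>g\<close> weight \<open>w\<close>, so the factor \<open>F v w\<close> is common to all
  pairs of words and comes out of the product.\<close>

lemma rescale_mult_homogeneous:
  assumes c: "\<And>u v. c (u @ v) = F (word_weight u) (word_weight v) * c u * c v"
    and f: "homogeneous v f" and g: "homogeneous w g"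
  shows "rescale c (f * g) = scalar (F v w) * (rescale c f * rescale c g)"
proof -
  have words: "rescale c (component v (Poly_Mapping.single x a) * component w (Poly_Mapping.single y b))
      = scalar (F v w) * (rescale c (component v (Poly_Mapping.single x a))
          * rescale c (component w (Poly_Mapping.single y b)))" for x y a b
    by (simp add: single_mult_single scalar_mult_eq_rescale c mult_ac)
  have "rescale c (component v f * component w g)
      = scalar (F v w) * (rescale c (component v f) * rescale c (component w g))"
  proof (induction f rule: free_alg_induct)
    case (single x a)
    show ?case
    proof (induction g rule: free_alg_induct)
      case (single y b)
      show ?case by (rule words)
    qed (simp only: component_add rescale_add distrib_left)
  qed (simp only: component_add rescale_add distrib_left distrib_right)
  then show ?thesis using f g by (simp add: homogeneous_def)
qed

text \<open>The right side has the shape of \<open>twisted_mult\<close>, with arbitrary finite index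
  sets that contain the occurring weights.\<close>

lemma rescale_mult:
  assumes c: "\<And>u v. c (u @ v) = F (word_weight u) (word_weight v) * c u * c v"
    and V: "finite V" "word_weight ` Poly_Mapping.keys f \<subseteq> V"
    and W: "finite W" "word_weight ` Poly_Mapping.keys g \<subseteq> W"
  shows "rescale c (f * g) = (\<Sum>(v, w)\<in>V \<times> W.
      scalar (F v w) * (component v (rescale c f) * component w (rescale c g)))"
proof -
  have "rescale c (f * g) = rescale c ((\<Sum>v\<in>V. component v f) * (\<Sum>w\<in>W. component w g))"
    using sum_component[OF V] sum_component[OF W] by simp
  also have "\<dots> = (\<Sum>(v, w)\<in>V \<times> W. rescale c (component v f * component w g))"
    by (simp add: sum_product rescale_sum sum.cartesian_product case_prod_beta)
  also have "\<dots> = (\<Sum>(v, w)\<in>V \<times> W.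
      scalar (F v w) * (component v (rescale c f) * component w (rescale c g)))"
    using rescale_mult_homogeneous[of c F, OF c]
    by (intro sum.cong refl) (simp add: component_rescale split: prod.split)
  finally show ?thesis .
qed

text \<open>The product formula involves the single components of \<open>rescale c f\<close>, and
  gradedness puts each of them in \<open>I\<close>. \<open>F\<close> is arbitrary so that the lemma
  serves both the twist, with the cocycle, and its inverse, with the inverse cocycle.\<close>

lemma ideal_rescale_vimage:
  fixes I :: "('r, 'n) free_alg set"
  assumes I: "ideal I free_ring" and gr: "graded I"
    and c: "\<And>u v. c (u @ v) = F (word_weight u) (word_weight v) * c u * c v"
  shows "ideal {f. rescale c f \<in> I} free_ring"
proof (rule ideal_free_ringI)
  fix f g :: "('r, 'n) free_alg"
  assume f: "f \<in> {f. rescale c f \<in> I}"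
  let ?V = "word_weight ` Poly_Mapping.keys f" and ?W = "word_weight ` Poly_Mapping.keys g"
  have comp: "component v (rescale c f) \<in> I" for v
    using f gr by (simp add: graded_def)
  have "rescale c (g * f) = (\<Sum>(w, v)\<in>?W \<times> ?V.
      scalar (F w v) * (component w (rescale c g) * component v (rescale c f)))"
    by (rule rescale_mult[OF c]) auto
  also have "\<dots> \<in> I"
    using ideal_mult_left[OF I ideal_mult_left[OF I comp]] by (intro ideal_sum[OF I]) auto
  finally show "g * f \<in> {f. rescale c f \<in> I}" by simp
  have "rescale c (f * g) = (\<Sum>(v, w)\<in>?V \<times> ?W.
      scalar (F v w) * (component v (rescale c f) * component w (rescale c g)))"
    by (rule rescale_mult[OF c]) auto
  also have "\<dots> \<in> I"
    using ideal_mult_left[OF I ideal_mult_right[OF I comp]] by (intro ideal_sum[OF I]) auto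
  finally show "f * g \<in> {f. rescale c f \<in> I}" by simp
qed (auto simp: rescale_add ideal_zero[OF I] ideal_add[OF I])


section \<open>The cocycle\<close>

lemma weight_exhaust:
  obtains a where "w = abs_weight a"
  using Quotient3_abs_rep[OF Quotient3_weight] by metis

lemma cnj_exp: "cnj (exp z) = exp (cnj z)"
  by (simp add: complex_eq_iff Re_exp Im_exp)

lemma bilin_add_left: "bilin \<theta> (\<lambda>\<mu>. a \<mu> + b \<mu>) c = bilin \<theta> a c + bilin \<theta> b c"
  by (simp add: bilin_def sum.distrib algebra_simps)

lemma bilin_add_right: "bilin \<theta> c (\<lambda>\<mu>. a \<mu> + b \<mu>) = bilin \<theta> c a + bilin \<theta> c b"
  by (simp add: bilin_def sum.distrib algebra_simps)

lemma bilin_minus_left: "bilin \<theta> (\<lambda>\<mu>. - a \<mu>) c = - bilin \<theta> a c"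
  by (simp add: bilin_def sum_negf)

lemma bilin_minus_right: "bilin \<theta> c (\<lambda>\<mu>. - a \<mu>) = - bilin \<theta> c a"
  by (simp add: bilin_def sum_negf)

lemma bilin_unit:
  "bilin \<theta> (\<lambda>\<kappa>. if \<kappa> = \<mu> then 1 else 0) (\<lambda>\<kappa>. if \<kappa> = \<nu> then 1 else 0) = \<theta> $ \<mu> $ \<nu>"
proof -
  have unit: "of_int (if P then 1 else 0) = (if P then 1 else (0 :: complex))" for P by simp
  have "bilin \<theta> (\<lambda>\<kappa>. if \<kappa> = \<mu> then 1 else 0) (\<lambda>\<kappa>. if \<kappa> = \<nu> then 1 else 0)
      = (\<Sum>\<kappa>\<in>UNIV. if \<kappa> = \<mu> then \<Sum>\<rho>\<in>UNIV. if \<rho> = \<nu> then \<theta> $ \<kappa> $ \<rho> else 0 else 0)"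
    unfolding bilin_def unit
    by (intro sum.cong refl)
      (simp only: if_distrib[of "\<lambda>x. x * _"] if_distrib[of "\<lambda>x. _ * x"] mult_1 mult_1_right
        mult_zero_left mult_zero_right sum.neutral_const cong: if_cong, simp)
  then show ?thesis by simp
qed

lemma hat_phase_nonzero [simp]: "hat_phase \<theta> \<mu> \<nu> \<noteq> 0"
  by (simp add: hat_phase_def)

lemma hat_phase_diagonal [simp]: "hat_phase \<theta> \<mu> \<mu> = 1"
  by (simp add: hat_phase_def)

text \<open>The transposed phase on adjoints is the conjugate of the original one when \<theta> is
  anti-Hermitian (\<open>cnj_hat_phase\<close>).\<close>

primrec letter_phase :: "complex^'n^'n \<Rightarrow> ('r, 'n) letter \<Rightarrow> complex" where
  "letter_phase \<theta> (Entry i \<mu> \<nu>) = hat_phase \<theta> \<mu> \<nu>"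
| "letter_phase \<theta> (EntryStar i \<mu> \<nu>) = hat_phase \<theta> \<nu> \<mu>"

text \<open>The coefficient of the ordinary monomial in the \<bullet>-product of the letters with
  hats, bracketed to the right.\<close>

primrec word_phase :: "complex^'n^'n \<Rightarrow> ('r, 'n::finite) letter list \<Rightarrow> complex" where
  "word_phase \<theta> [] = 1"
| "word_phase \<theta> (x # u) =
     cocycle \<theta> (letter_weight x) (word_weight u) * letter_phase \<theta> x * word_phase \<theta> u"

lemma cocycle_nonzero [simp]: "cocycle \<theta> v w \<noteq> 0"
  by (simp add: cocycle_def)

lemma word_phase_nonzero [simp]: "word_phase \<theta> u \<noteq> 0"
proof (induction u)
  case (Cons x u)
  then show ?case by (cases x) auto
qed simp

section \<open>The cocycle as a bicharacter, and the twist it defines\<close>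

locale theta_matrix =
  fixes \<theta> :: "complex^'n::finite^'n"
  assumes rows: "\<And>\<mu>. (\<Sum>\<nu>\<in>UNIV. \<theta> $ \<mu> $ \<nu>) = 0"
    and cols: "\<And>\<nu>. (\<Sum>\<mu>\<in>UNIV. \<theta> $ \<mu> $ \<nu>) = 0"
    and antiherm: "\<And>\<mu> \<nu>. cnj (\<theta> $ \<nu> $ \<mu>) = - \<theta> $ \<mu> $ \<nu>"
begin

lemmas cocycle_abs_weight = cocycle_abs[OF rows cols]

lemma cocycle_add_left: "cocycle \<theta> (v + v') w = cocycle \<theta> v w * cocycle \<theta> v' w"
  by (rule weight_exhaust[of v]; rule weight_exhaust[of v']; rule weight_exhaust[of w])
    (simp add: plus_weight.abs_eq cocycle_abs_weight bilin_add_left distrib_left exp_add)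

lemma cocycle_add_right: "cocycle \<theta> v (w + w') = cocycle \<theta> v w * cocycle \<theta> v w'"
  by (rule weight_exhaust[of v]; rule weight_exhaust[of w]; rule weight_exhaust[of w'])
    (simp add: plus_weight.abs_eq cocycle_abs_weight bilin_add_right distrib_left exp_add)

lemma cocycle_zero_left [simp]: "cocycle \<theta> 0 w = 1"
  using cocycle_add_left[of 0 0 w] by simp

lemma cocycle_zero_right [simp]: "cocycle \<theta> v 0 = 1"
  using cocycle_add_right[of v 0 0] by simp

lemma cocycle_uminus [simp]: "cocycle \<theta> (- v) (- w) = cocycle \<theta> v w"
  by (rule weight_exhaust[of v]; rule weight_exhaust[of w])
    (simp add: uminus_weight.abs_eq cocycle_abs_weight bilin_minus_left bilin_minus_right)

lemma cnj_bilin: "cnj (bilin \<theta> a b) = - bilin \<theta> b a"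
proof -
  have "cnj (bilin \<theta> a b) = (\<Sum>\<mu>\<in>UNIV. \<Sum>\<nu>\<in>UNIV. - (of_int (b \<nu>) * \<theta> $ \<nu> $ \<mu> * of_int (a \<mu>)))"
    by (simp add: bilin_def cnj_sum antiherm mult_ac)
  also have "\<dots> = - bilin \<theta> b a"
    by (subst sum.swap) (simp add: bilin_def sum_negf)
  finally show ?thesis .
qed

text \<open>Conjugation changes the sign of both \<i> and the form, and transposes the form, since
  \<theta> is anti-Hermitian.\<close>

lemma cnj_cocycle: "cnj (cocycle \<theta> v w) = cocycle \<theta> w v"
  by (simp add: cocycle_def cnj_bilin cnj_exp)

lemma cocycle_t_gen:
  "cocycle \<theta> (t_gen \<mu> - t_gen \<nu>) (t_gen \<alpha> - t_gen \<beta>)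
    = exp (\<i> * (\<theta> $ \<mu> $ \<alpha> - \<theta> $ \<mu> $ \<beta> - \<theta> $ \<nu> $ \<alpha> + \<theta> $ \<nu> $ \<beta>))"
  by (simp add: minus_weight_def t_gen.abs_eq plus_weight.abs_eq uminus_weight.abs_eq
      cocycle_abs_weight bilin_add_left bilin_add_right bilin_minus_left bilin_minus_right bilin_unit
      del: add_uminus_conv_diff flip: add_uminus_conv_diff) (simp add: algebra_simps)

lemma cnj_hat_phase: "cnj (hat_phase \<theta> \<mu> \<nu>) = hat_phase \<theta> \<nu> \<mu>"
  by (simp add: hat_phase_def antiherm cnj_exp algebra_simps)

text \<open>The off-diagonal terms containing \<kappa> cancel against those of the cocycle, and the
  two halves of \<open>\<theta> $ \<kappa> $ \<kappa>\<close> in the phases cancel its diagonal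
  term. What remains is independent of \<kappa>.\<close>

lemma hat_phase_mult:
  "cocycle \<theta> (t_gen \<mu> - t_gen \<kappa>) (t_gen \<kappa> - t_gen \<nu>) * (hat_phase \<theta> \<mu> \<kappa> * hat_phase \<theta> \<kappa> \<nu>)
    = hat_phase \<theta> \<mu> \<nu>"
  unfolding cocycle_t_gen hat_phase_def exp_add[symmetric]
  by (rule arg_cong[where f = exp]) (simp add: algebra_simps)

text \<open>Bracketing is immaterial: for a bicharacter \<open>F\<close>, both
  \<open>F(x, u + v) F(u, v)\<close> and \<open>F(x + u, v) F(x, u)\<close> equal
  \<open>F(x, u) F(x, v) F(u, v)\<close>.\<close>

lemma word_phase_append:
  "word_phase \<theta> (u @ v) =
    cocycle \<theta> (word_weight u) (word_weight v) * word_phase \<theta> u * word_phase \<theta> v"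
  by (induction u) (simp_all add: word_weight_append cocycle_add_left cocycle_add_right mult_ac)

text \<open>Reversal exchanges the arguments of each cocycle factor, as conjugation does; the
  negated weights do not matter by \<open>cocycle_uminus\<close>.\<close>

lemma word_phase_word_star: "word_phase \<theta> (word_star u) = cnj (word_phase \<theta> u)"
proof (induction u)
  case (Cons x u)
  have "letter_phase \<theta> (letter_star x) = cnj (letter_phase \<theta> x)"
    by (cases x) (simp_all add: cnj_hat_phase)
  moreover have "word_star (x # u) = word_star u @ [letter_star x]"
    by (simp add: word_star_def)
  ultimately show ?case
    using Cons by (simp add: word_phase_append cnj_cocycle mult_ac)
qed (simp add: word_star_def)

abbreviation twist :: "('r, 'n) free_alg \<Rightarrow> ('r, 'n) free_alg" where
  "twist \<equiv> rescale (word_phase \<theta>)"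

abbreviation untwist :: "('r, 'n) free_alg \<Rightarrow> ('r, 'n) free_alg" where
  "untwist \<equiv> rescale (\<lambda>u. inverse (word_phase \<theta> u))"

lemmas twist_untwist = rescale_inverse(1)[of "word_phase \<theta>", OF word_phase_nonzero]
lemmas untwist_twist = rescale_inverse(2)[of "word_phase \<theta>", OF word_phase_nonzero]

lemma star_twist: "star (twist f) = twist (star f)"
  by (simp add: star_rescale word_phase_word_star)

lemma star_untwist: "star (untwist f) = untwist (star f)"
  by (simp add: star_rescale word_phase_word_star)

text \<open>Puts the inverse phase into the form expected by
  \<open>ideal_rescale_vimage\<close>.\<close>

lemma inverse_word_phase_append:
  "inverse (word_phase \<theta> (u @ v)) =
    inverse (cocycle \<theta> (word_weight u) (word_weight v))
      * inverse (word_phase \<theta> u) * inverse (word_phase \<theta> v)"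
  by (simp add: word_phase_append)

lemmas twist_mult_homogeneous =
  rescale_mult_homogeneous[of "word_phase \<theta>" "cocycle \<theta>", OF word_phase_append]

lemma twist_var: "twist (var x) = scalar (letter_phase \<theta> x) * var x"
  by (simp add: var_def scalar_mult_eq_rescale)

lemma twist_one: "twist 1 = 1"
  by (simp add: one_free_alg)

lemma twist_scalar: "twist (scalar c) = scalar c"
  by (simp add: scalar_def)

text \<open>
  The diagonal terms of the phases are chosen so that they absorb the cocycle factor of
  \<open>t\<^sub>\<mu> t\<^sub>\<kappa>\<^sup>-\<^sup>1\<close> and \<open>t\<^sub>\<kappa> t\<^sub>\<nu>\<^sup>-\<^sup>1\<close> (lemma \<open>hat_phase_mult\<close>): the sum over \<open>\<kappa>\<close> in a matrix product keeps
  its form.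
\<close>

lemma
  fixes A :: "'r mat_exp" and s :: "'r scal_exp"
  shows mat_eval_aux: "\<forall>\<mu> \<nu>. homogeneous (t_gen \<mu> - t_gen \<nu>) (mat_eval A \<mu> \<nu>)
      \<and> twist (mat_eval A \<mu> \<nu>) = scalar (hat_phase \<theta> \<mu> \<nu>) * mat_eval A \<mu> \<nu>"
    and scal_eval_aux: "homogeneous 0 (scal_eval s :: ('r, 'n) free_alg)
      \<and> twist (scal_eval s) = scal_eval s"
proof (induction A and s)
  case (Gen i)
  have "homogeneous (t_gen \<mu> - t_gen \<nu>) (var (Entry i \<mu> \<nu>))" for \<mu> \<nu> :: 'n
    using homogeneous_var[of "Entry i \<mu> \<nu>"] by simp
  then show ?case by (simp add: twist_var)
next
  case One
  show ?case by (simp add: homogeneous_one twist_one)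
next
  case (Plus A B)
  then show ?case by (simp add: homogeneous_add rescale_add distrib_left)
next
  case (Scale s A)
  show ?case
  proof (intro allI conjI)
    fix \<mu> \<nu> :: 'n
    let ?w = "t_gen \<mu> - t_gen \<nu>"
    have hom: "homogeneous 0 (scal_eval s :: ('r, 'n) free_alg)" "homogeneous ?w (mat_eval A \<mu> \<nu>)"
      using Scale by auto
    show "homogeneous ?w (mat_eval (Scale s A) \<mu> \<nu>)"
      using homogeneous_mult[OF hom] by simp
    \<comment> \<open>The scalar expression has weight 0, so the cocycle factor is 1.\<close>
    show "twist (mat_eval (Scale s A) \<mu> \<nu>) = scalar (hat_phase \<theta> \<mu> \<nu>) * mat_eval (Scale s A) \<mu> \<nu>"
      using Scale twist_mult_homogeneous[OF hom]
      by (simp add: mult.assoc[symmetric] scalar_central[symmetric])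
  qed
next
  case (Prod A B)
  show ?case
  proof (intro allI conjI)
    fix \<mu> \<nu> :: 'n
    have hom: "homogeneous (t_gen \<mu> - t_gen \<kappa>) (mat_eval A \<mu> \<kappa>)"
      "homogeneous (t_gen \<kappa> - t_gen \<nu>) (mat_eval B \<kappa> \<nu>)" for \<kappa>
      using Prod by auto
    have "homogeneous (t_gen \<mu> - t_gen \<nu>) (mat_eval A \<mu> \<kappa> * mat_eval B \<kappa> \<nu>)" for \<kappa>
      using homogeneous_mult[OF hom[of \<kappa>]] by simp
    then show "homogeneous (t_gen \<mu> - t_gen \<nu>) (mat_eval (Prod A B) \<mu> \<nu>)"
      by (simp add: homogeneous_sum)
    have "twist (mat_eval A \<mu> \<kappa> * mat_eval B \<kappa> \<nu>)
        = scalar (hat_phase \<theta> \<mu> \<nu>) * (mat_eval A \<mu> \<kappa> * mat_eval B \<kappa> \<nu>)" for \<kappa>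
      using Prod unfolding twist_mult_homogeneous[OF hom[of \<kappa>]]
      by (simp add: scalar_mult_mult_scalar_mult scalar_mult_scalar_mult hat_phase_mult)
    then show "twist (mat_eval (Prod A B) \<mu> \<nu>) = scalar (hat_phase \<theta> \<mu> \<nu>) * mat_eval (Prod A B) \<mu> \<nu>"
      by (simp add: rescale_sum sum_distrib_left)
  qed
next
  case (Dagger A)
  show ?case
  proof (intro allI conjI)
    fix \<mu> \<nu> :: 'n
    have "homogeneous (- (t_gen \<nu> - t_gen \<mu>)) (star (mat_eval A \<nu> \<mu>))"
      using Dagger by (intro homogeneous_star) auto
    then show "homogeneous (t_gen \<mu> - t_gen \<nu>) (mat_eval (Dagger A) \<mu> \<nu>)" by simp
    show "twist (mat_eval (Dagger A) \<mu> \<nu>) = scalar (hat_phase \<theta> \<mu> \<nu>) * mat_eval (Dagger A) \<mu> \<nu>"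
      using Dagger by (simp add: star_scalar_mult cnj_hat_phase flip: star_twist)
  qed
next
  case (Const c)
  show ?case by (simp add: homogeneous_scalar twist_scalar)
next
  case (Trace A)
  \<comment> \<open>Diagonal entries have weight 0 and phase 1, so the twist fixes the
    trace.\<close>
  then have "homogeneous 0 (mat_eval A \<mu> \<mu>)" for \<mu> :: 'n
    by (metis cancel_comm_monoid_add_class.diff_cancel)
  then show ?case using Trace by (simp add: homogeneous_sum rescale_sum)
next
  case (SPlus s t)
  then show ?case by (simp add: homogeneous_add rescale_add)
next
  case (SProd s t)
  then show ?case
    using homogeneous_mult[of 0 "scal_eval s :: ('r, 'n) free_alg" 0 "scal_eval t"]
      twist_mult_homogeneous[of 0 "scal_eval s" 0 "scal_eval t"] by simp
qed

lemmas homogeneous_mat_eval = mat_eval_aux[rule_format, THEN conjunct1]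
lemmas twist_mat_eval = mat_eval_aux[rule_format, THEN conjunct2]
lemmas homogeneous_scal_eval = scal_eval_aux[THEN conjunct1]
lemmas twist_scal_eval = scal_eval_aux[THEN conjunct2]

end

section \<open>Commutation modulo an ideal\<close>

definition commute_mod :: "('r, 'n) free_alg set \<Rightarrow> ('r, 'n) free_alg \<Rightarrow> ('r, 'n) free_alg \<Rightarrow> bool"
  where "commute_mod J f g \<longleftrightarrow> f * g - g * f \<in> J"

lemma commute_mod_sym:
  assumes "ideal J free_ring" and "commute_mod J f g"
  shows "commute_mod J g f"
  using ideal_diff[OF assms(1) ideal_zero[OF assms(1)] assms(2)[unfolded commute_mod_def]]
  by (simp add: commute_mod_def)

lemma commute_mod_add:
  assumes "ideal J free_ring" and "commute_mod J f g" and "commute_mod J f h"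
  shows "commute_mod J f (g + h)"
proof -
  have "f * (g + h) - (g + h) * f = (f * g - g * f) + (f * h - h * f)"
    by (simp add: algebra_simps)
  then show ?thesis using assms(2,3) by (simp add: commute_mod_def ideal_add[OF assms(1)])
qed

text \<open>The commutator with \<open>f\<close> is a derivation.\<close>

lemma commute_mod_mult:
  assumes "ideal J free_ring" and "commute_mod J f g" and "commute_mod J f h"
  shows "commute_mod J f (g * h)"
proof -
  have "f * (g * h) - (g * h) * f = (f * g - g * f) * h + g * (f * h - h * f)"
    by (simp add: algebra_simps)
  then show ?thesis using assms(2,3)
    by (simp add: commute_mod_def ideal_add[OF assms(1)] ideal_mult_left[OF assms(1)]
        ideal_mult_right[OF assms(1)])
qed

lemma commute_mod_scalar: "ideal J free_ring \<Longrightarrow> commute_mod J f (scalar c)"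
  by (simp add: commute_mod_def ideal_zero flip: scalar_central)

lemma commute_mod_ideal: "ideal J free_ring \<Longrightarrow> g \<in> J \<Longrightarrow> commute_mod J f g"
  by (simp add: commute_mod_def ideal_diff ideal_mult_left ideal_mult_right)

lemma commute_mod_sum:
  assumes "ideal J free_ring" and "\<And>x. x \<in> A \<Longrightarrow> commute_mod J f (g x)"
  shows "commute_mod J f (sum g A)"
  using assms(2) commute_mod_ideal[OF assms(1) ideal_zero[OF assms(1)]]
  by (induction A rule: infinite_finite_induct) (auto intro: commute_mod_add[OF assms(1)])

lemma commute_mod_letters:
  assumes J: "ideal J free_ring" and letters: "\<And>x. commute_mod J f (var x)"
  shows "commute_mod J f g"
proof (induction g rule: free_alg_induct)
  case (single u c)
  show ?case
  proof (induction u)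
    case Nil
    show ?case using commute_mod_scalar[OF J, of f c] by (simp add: scalar_def)
  next
    case (Cons x u)
    have "Poly_Mapping.single (x # u) c = var x * Poly_Mapping.single u c"
      by (simp add: var_def single_mult_single)
    then show ?case using commute_mod_mult[OF J letters Cons] by simp
  qed
qed (rule commute_mod_add[OF J])

text \<open>Without daggers an expression is a polynomial in the letters \<open>Entry\<close>, so
  commuting with these letters suffices.\<close>

lemma
  fixes A :: "'r mat_exp" and s :: "'r scal_exp" and J :: "('r, 'n::finite) free_alg set"
  assumes J: "ideal J free_ring" and entries: "\<And>i \<mu> \<nu>. commute_mod J f (var (Entry i \<mu> \<nu>))"
  shows commute_mod_mat_eval: "mat_dagger_free A \<longrightarrow> (\<forall>\<mu> \<nu>. commute_mod J f (mat_eval A \<mu> \<nu>))"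
    and commute_mod_scal_eval: "scal_dagger_free s \<longrightarrow> commute_mod J f (scal_eval s)"
proof (induction A and s)
  case One
  show ?case using commute_mod_scalar[OF J, of f 0] commute_mod_scalar[OF J, of f 1] by simp
qed (auto simp: entries commute_mod_scalar[OF J]
    intro!: commute_mod_add[OF J] commute_mod_mult[OF J] commute_mod_sum[OF J])

text \<open>
  A specified adjoint is congruent to a polynomial in the entries of the \<open>P\<^sub>i\<close>, so an element commuting
  with the generating matrices is central; by symmetry this applies first to the generators
  themselves and then to every element.
\<close>

lemma commute_mod_gen_matrices:
  fixes J :: "('r, 'n::finite) free_alg set"
  assumes J: "ideal J free_ring" and rels: "rel_elems R \<subseteq> J"
    and gens: "\<And>A B \<mu> \<nu> \<alpha> \<beta>. A \<in> gen_matrices R \<Longrightarrow> B \<in> gen_matrices R \<Longrightarrow>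
      commute_mod J (mat_eval A \<mu> \<nu>) (mat_eval B \<alpha> \<beta>)"
  shows "commute_mod J f g"
proof -
  have central: "commute_mod J f g"
    if f: "\<And>A \<mu> \<nu>. A \<in> gen_matrices R \<Longrightarrow> commute_mod J f (mat_eval A \<mu> \<nu>)" for f g
  proof (rule commute_mod_letters[OF J])
    have entry: "commute_mod J f (var (Entry i \<mu> \<nu>))" for i \<mu> \<nu>
      using f[of "Gen i" \<mu> \<nu>] by (simp add: gen_matrices_def)
    fix x
    show "commute_mod J f (var x)"
    proof (cases x)
      case (Entry i \<mu> \<nu>)
      then show ?thesis using entry by simp
    next
      case (EntryStar i \<mu> \<nu>)
      then have x: "var x = mat_eval (Dagger (Gen i)) \<nu> \<mu>" by simp
      show ?thesis
      proof (cases "dagger_specified R i")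
        case True
        then obtain E where E: "mat_dagger_free E" "MatEq (Dagger (Gen i)) E \<in> R"
          by (auto simp: dagger_specified_def)
        have "mat_eval (Dagger (Gen i)) \<nu> \<mu> - mat_eval E \<nu> \<mu> \<in> rel_elems R"
          using E(2) unfolding rel_elems_def by blast
        then have "var x - mat_eval E \<nu> \<mu> \<in> J" using rels x by auto
        moreover have "commute_mod J f (mat_eval E \<nu> \<mu>)"
          using commute_mod_mat_eval[OF J entry, of E] E(1) by blast
        ultimately have "commute_mod J f (mat_eval E \<nu> \<mu> + (var x - mat_eval E \<nu> \<mu>))"
          using commute_mod_add[OF J _ commute_mod_ideal[OF J]] by blast
        then show ?thesis by simp
      next
        case False
        then have "Dagger (Gen i) \<in> gen_matrices R" by (auto simp: gen_matrices_def)
        then show ?thesis using f x by metis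
      qed
    qed
  qed
  show ?thesis by (rule central, rule commute_mod_sym[OF J], rule central, rule gens)
qed


section \<open>The quantum and the classical ideal\<close>

lemma ideal_coord_ideal: "ideal (coord_ideal R) free_ring"
  unfolding coord_ideal_def by (rule ideal_star_ideal)

lemma ideal_quantum_ideal: "ideal (quantum_ideal \<theta> R) free_ring"
  unfolding quantum_ideal_def by (rule ideal_star_ideal)

lemma commutator_in_coord_ideal: "f * g - g * f \<in> coord_ideal R"
  unfolding coord_ideal_def by (rule star_ideal_generator, rule UnI1) auto

lemma rel_elems_subset_coord_ideal: "rel_elems R \<subseteq> coord_ideal R"
  unfolding coord_ideal_def by (intro subsetI star_ideal_generator UnI2)

lemma star_in_coord_ideal: "f \<in> coord_ideal R \<Longrightarrow> star f \<in> coord_ideal R"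
  unfolding coord_ideal_def by (rule star_in_star_ideal)

lemma component_homogeneous_in_ideal:
  assumes "ideal I free_ring" and "homogeneous w s" and "s \<in> I"
  shows "component v s \<in> I"
  using assms by (simp add: component_homogeneous ideal_zero)

section \<open>Homogeneous relations and graded ideals\<close>

context theta_matrix
begin

text \<open>Weight and eigenvalue of an entry depend only on its position, so the two sides of a
  matrix relation share them and their difference is again an eigenvector.\<close>

lemma rel_elems_homogeneous:
  assumes "s \<in> rel_elems R"
  obtains w c where "homogeneous w s" and "c \<noteq> 0" and "twist s = scalar c * s"
proof -
  from assms consider
    (mat) A B \<mu> \<nu> where "s = mat_eval A \<mu> \<nu> - mat_eval B \<mu> \<nu>"
    | (scal) a b where "s = scal_eval a - scal_eval b"
    unfolding rel_elems_def by (elim UnE CollectE exE conjE) (rule that)+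
  then show ?thesis
  proof cases
    case mat
    show ?thesis
    proof (rule that)
      show "homogeneous (t_gen \<mu> - t_gen \<nu>) s"
        unfolding mat by (intro homogeneous_diff homogeneous_mat_eval)
      show "twist s = scalar (hat_phase \<theta> \<mu> \<nu>) * s"
        by (simp add: mat rescale_diff twist_mat_eval right_diff_distrib)
    qed simp
  next
    case scal
    show ?thesis
    proof (rule that)
      show "homogeneous 0 s"
        unfolding scal by (intro homogeneous_diff homogeneous_scal_eval)
      show "twist s = scalar 1 * s"
        by (simp add: scal rescale_diff twist_scal_eval)
    qed simp
  qed
qed

lemma commutation_elems_homogeneous:
  assumes "s \<in> commutation_elems \<theta> R"
  obtains w where "homogeneous w s"
proof -
  from assms obtain A B \<mu> \<nu> \<alpha> \<beta> c where
    "s = mat_eval A \<mu> \<nu> * mat_eval B \<alpha> \<beta> - scalar c * (mat_eval B \<alpha> \<beta> * mat_eval A \<mu> \<nu>)"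
    unfolding commutation_elems_def by blast
  moreover have "homogeneous ((t_gen \<mu> - t_gen \<nu>) + (t_gen \<alpha> - t_gen \<beta>))
      (mat_eval A \<mu> \<nu> * mat_eval B \<alpha> \<beta>)"
    by (intro homogeneous_mult homogeneous_mat_eval)
  moreover have "homogeneous ((t_gen \<mu> - t_gen \<nu>) + (t_gen \<alpha> - t_gen \<beta>))
      (mat_eval B \<alpha> \<beta> * mat_eval A \<mu> \<nu>)"
    by (subst add.commute) (intro homogeneous_mult homogeneous_mat_eval)
  ultimately show ?thesis
    by (intro that) (auto intro: homogeneous_diff homogeneous_scalar_mult)
qed

text \<open>Commutators of arbitrary elements are not homogeneous, but bilinearity reduces them to
  commutators of words, which are.\<close>

lemma graded_coord_ideal: "graded (coord_ideal R :: ('r, 'n) free_alg set)"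
proof -
  let ?I = "coord_ideal R :: ('r, 'n) free_alg set"
  note I = ideal_coord_ideal[of R]
  have comm: "component w (f * g - g * f) \<in> ?I" for w and f g :: "('r, 'n) free_alg"
  proof (induction f rule: free_alg_induct)
    case (single u a)
    show ?case
    proof (induction g rule: free_alg_induct)
      case (single v b)
      let ?f = "Poly_Mapping.single u a" and ?g = "Poly_Mapping.single v b"
      have "homogeneous (word_weight u + word_weight v) (?f * ?g)"
        by (intro homogeneous_mult homogeneous_single)
      moreover have "homogeneous (word_weight u + word_weight v) (?g * ?f)"
        by (subst add.commute) (intro homogeneous_mult homogeneous_single)
      ultimately show ?case
        by (intro component_homogeneous_in_ideal[OF I homogeneous_diff] commutator_in_coord_ideal)
    next
      case (add g h)
      have "f * (g + h) - (g + h) * f = (f * g - g * f) + (f * h - h * f)"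
        for f :: "('r, 'n) free_alg" by (simp add: algebra_simps)
      then show ?case using ideal_add[OF I add] by (simp only: component_add)
    qed
  next
    case (add f h)
    have "(f + h) * g - g * (f + h) = (f * g - g * f) + (h * g - g * h)"
      by (simp add: algebra_simps)
    then show ?case using ideal_add[OF I add] by (simp only: component_add)
  qed
  have rel: "component w s \<in> ?I" if s: "s \<in> rel_elems R" for s w
  proof (rule rel_elems_homogeneous[OF s])
    fix v assume "homogeneous v s"
    then show ?thesis
      using component_homogeneous_in_ideal[OF I] s rel_elems_subset_coord_ideal by blast
  qed
  show ?thesis
    unfolding coord_ideal_def
  proof (rule graded_star_ideal, fold coord_ideal_def)
    fix s :: "('r, 'n) free_alg" and w
    assume "s \<in> {f * g - g * f | f g. True} \<union> rel_elems R"
    then show "component w s \<in> ?I" using comm rel by blast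
  qed
qed

lemma generators_in_quantum_ideal: "commutation_elems \<theta> R \<union> rel_elems R \<subseteq> quantum_ideal \<theta> R"
  unfolding quantum_ideal_def using star_ideal_superset by blast

lemma graded_quantum_ideal: "graded (quantum_ideal \<theta> R)"
proof -
  have "component w s \<in> quantum_ideal \<theta> R" if s: "s \<in> commutation_elems \<theta> R \<union> rel_elems R" for s w
  proof -
    obtain v where "homogeneous v s"
      using s by (blast elim: commutation_elems_homogeneous rel_elems_homogeneous)
    then show ?thesis
      using s generators_in_quantum_ideal component_homogeneous_in_ideal[OF ideal_quantum_ideal]
      by blast
  qed
  then show ?thesis unfolding quantum_ideal_def by (rule graded_star_ideal)
qed

abbreviation commutation_phase :: "'n \<Rightarrow> 'n \<Rightarrow> 'n \<Rightarrow> 'n \<Rightarrow> complex" where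
  "commutation_phase \<mu> \<nu> \<alpha> \<beta> \<equiv> exp (2 * \<i> * (theta_minus \<theta> \<mu> \<alpha> - theta_minus \<theta> \<nu> \<alpha>
      + theta_minus \<theta> \<nu> \<beta> - theta_minus \<theta> \<mu> \<beta>))"

text \<open>The commutation phase is the quotient \<open>F(v,w) / F(w,v)\<close>; antisymmetrising
  \<theta> with its factor 1/2 accounts for the 2 in the exponent.\<close>

lemma cocycle_commute:
  "commutation_phase \<mu> \<nu> \<alpha> \<beta> * cocycle \<theta> (t_gen \<alpha> - t_gen \<beta>) (t_gen \<mu> - t_gen \<nu>)
    = cocycle \<theta> (t_gen \<mu> - t_gen \<nu>) (t_gen \<alpha> - t_gen \<beta>)"
  unfolding cocycle_t_gen exp_add[symmetric]
  by (rule arg_cong[where f = exp]) (simp add: theta_minus_def field_simps)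

text \<open>The phases of the two entries contribute equally to both orders of the product; only the
  cocycle factors differ, and the commutation phase compensates for that.\<close>

lemma twist_commutation:
  fixes A B :: "'r mat_exp" and \<mu> \<nu> \<alpha> \<beta> :: 'n
  defines "X \<equiv> mat_eval A \<mu> \<nu> :: ('r, 'n) free_alg" and "Y \<equiv> mat_eval B \<alpha> \<beta> :: ('r, 'n) free_alg"
  obtains c where "c \<noteq> 0"
    and "twist (X * Y - scalar (commutation_phase \<mu> \<nu> \<alpha> \<beta>) * (Y * X)) = scalar c * (X * Y - Y * X)"
proof
  let ?F = "cocycle \<theta> (t_gen \<mu> - t_gen \<nu>) (t_gen \<alpha> - t_gen \<beta>)"
    and ?F' = "cocycle \<theta> (t_gen \<alpha> - t_gen \<beta>) (t_gen \<mu> - t_gen \<nu>)"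
    and ?h = "hat_phase \<theta> \<mu> \<nu> * hat_phase \<theta> \<alpha> \<beta>"
  have XY: "twist (X * Y) = scalar (?F * ?h) * (X * Y)"
    unfolding X_def Y_def
    by (subst twist_mult_homogeneous[OF homogeneous_mat_eval homogeneous_mat_eval])
      (simp only: twist_mat_eval scalar_mult_mult_scalar_mult scalar_mult_scalar_mult)
  have YX: "twist (Y * X) = scalar (?F' * ?h) * (Y * X)"
    unfolding X_def Y_def
    by (subst twist_mult_homogeneous[OF homogeneous_mat_eval homogeneous_mat_eval])
      (simp only: twist_mat_eval scalar_mult_mult_scalar_mult scalar_mult_scalar_mult mult_ac(2)
        [of "hat_phase \<theta> \<alpha> \<beta>"])
  have "twist (scalar (commutation_phase \<mu> \<nu> \<alpha> \<beta>) * (Y * X))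
      = scalar (commutation_phase \<mu> \<nu> \<alpha> \<beta> * ?F' * ?h) * (Y * X)"
    by (simp only: rescale_scalar_mult YX scalar_mult_scalar_mult mult.assoc)
  also have "\<dots> = scalar (?F * ?h) * (Y * X)"
    by (simp only: cocycle_commute)
  finally show "twist (X * Y - scalar (commutation_phase \<mu> \<nu> \<alpha> \<beta>) * (Y * X))
      = scalar (?F * ?h) * (X * Y - Y * X)"
    by (simp only: rescale_diff XY right_diff_distrib)
  show "?F * ?h \<noteq> 0" by simp
qed

section \<open>The twist carries the quantum ideal onto the classical one\<close>

lemma untwist_eq:
  assumes "twist f = scalar c * g" and "c \<noteq> 0"
  shows "untwist g = scalar (inverse c) * f"
proof -
  have "f = scalar c * untwist g"
    using arg_cong[OF assms(1), of untwist] by (simp add: untwist_twist rescale_scalar_mult)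
  then show ?thesis using assms(2) by (simp add: scalar_mult_scalar_mult)
qed

lemma twist_quantum_ideal:
  assumes "f \<in> quantum_ideal \<theta> R"
  shows "twist f \<in> coord_ideal R"
proof -
  note I = ideal_coord_ideal[of R]
  have rel: "twist s \<in> coord_ideal R" if s: "s \<in> rel_elems R" for s
  proof (rule rel_elems_homogeneous[OF s])
    fix w c assume "twist s = scalar c * s"
    then show ?thesis using s rel_elems_subset_coord_ideal ideal_mult_left[OF I] by auto
  qed
  have comm: "twist s \<in> coord_ideal R" if "s \<in> commutation_elems \<theta> R" for s
  proof -
    from that obtain A B \<mu> \<nu> \<alpha> \<beta> where
      s: "s = mat_eval A \<mu> \<nu> * mat_eval B \<alpha> \<beta>
        - scalar (commutation_phase \<mu> \<nu> \<alpha> \<beta>) * (mat_eval B \<alpha> \<beta> * mat_eval A \<mu> \<nu>)"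
      unfolding commutation_elems_def by blast
    show ?thesis
      unfolding s
      by (rule twist_commutation[where A = A and B = B and \<mu> = \<mu> and \<nu> = \<nu>
            and \<alpha> = \<alpha> and \<beta> = \<beta>])
        (simp add: ideal_mult_left[OF I] commutator_in_coord_ideal)
  qed
  have "quantum_ideal \<theta> R \<subseteq> {f. twist f \<in> coord_ideal R}"
    unfolding quantum_ideal_def
  proof (rule star_ideal_minimal)
    show "ideal {f. twist f \<in> coord_ideal R} free_ring"
      by (rule ideal_rescale_vimage[OF I graded_coord_ideal word_phase_append])
    show "commutation_elems \<theta> R \<union> rel_elems R \<union> star ` (commutation_elems \<theta> R \<union> rel_elems R)
        \<subseteq> {f. twist f \<in> coord_ideal R}"
      using rel comm by (auto simp flip: star_twist intro!: star_in_coord_ideal)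
  qed
  then show ?thesis using assms by blast
qed

lemma untwist_coord_ideal:
  fixes R :: "'r mat_rel set"
  assumes "f \<in> coord_ideal R"
  shows "untwist f \<in> quantum_ideal \<theta> R"
proof -
  note Q = ideal_quantum_ideal[of \<theta> R]
  \<comment> \<open>This is the image of the quantum ideal under \<open>twist\<close>, written as a
    preimage under the inverse. The entries of the generating matrices commute modulo it, and
    \<open>commute_mod_gen_matrices\<close> extends this to all elements.\<close>
  let ?J = "{f. untwist f \<in> quantum_ideal \<theta> R} :: ('r, 'n) free_alg set"
  have J: "ideal ?J free_ring"
    by (rule ideal_rescale_vimage[OF Q graded_quantum_ideal inverse_word_phase_append])
  have rel: "rel_elems R \<subseteq> ?J"
  proof
    fix s :: "('r, 'n) free_alg" assume s: "s \<in> rel_elems R"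
    then have "s \<in> quantum_ideal \<theta> R" using generators_in_quantum_ideal by blast
    then have "scalar (inverse c) * s \<in> quantum_ideal \<theta> R" for c by (rule ideal_mult_left[OF Q])
    then show "s \<in> ?J" by (rule_tac rel_elems_homogeneous[OF s]) (simp add: untwist_eq)
  qed
  have comm: "f * g - g * f \<in> ?J" for f g
  proof -
    have "commute_mod ?J (mat_eval A \<mu> \<nu>) (mat_eval B \<alpha> \<beta>)"
      if "A \<in> gen_matrices R" "B \<in> gen_matrices R" for A B \<mu> \<nu> \<alpha> \<beta>
    proof -
      have "mat_eval A \<mu> \<nu> * mat_eval B \<alpha> \<beta>
          - scalar (commutation_phase \<mu> \<nu> \<alpha> \<beta>) * (mat_eval B \<alpha> \<beta> * mat_eval A \<mu> \<nu>)
          \<in> commutation_elems \<theta> R"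
        unfolding commutation_elems_def using that by blast
      then have "mat_eval A \<mu> \<nu> * mat_eval B \<alpha> \<beta>
          - scalar (commutation_phase \<mu> \<nu> \<alpha> \<beta>) * (mat_eval B \<alpha> \<beta> * mat_eval A \<mu> \<nu>)
          \<in> quantum_ideal \<theta> R"
        using generators_in_quantum_ideal by blast
      then show ?thesis
        by (rule_tac twist_commutation[where A = A and B = B and \<mu> = \<mu> and \<nu> = \<nu>
              and \<alpha> = \<alpha> and \<beta> = \<beta>])
          (simp add: commute_mod_def untwist_eq ideal_mult_left[OF Q])
    qed
    then have "commute_mod ?J f g" by (rule commute_mod_gen_matrices[OF J rel])
    then show ?thesis by (simp only: commute_mod_def)
  qed
  have star: "star s \<in> ?J" if "s \<in> ?J" for s
    using that star_in_star_ideal by (auto simp: quantum_ideal_def simp flip: star_untwist)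
  have "coord_ideal R \<subseteq> ?J"
    unfolding coord_ideal_def by (rule star_ideal_minimal[OF J]) (use rel comm star in blast)
  then show ?thesis using assms by blast
qed

lemma twist_image_quantum_ideal:
  "twist ` quantum_ideal \<theta> R = (coord_ideal R :: ('r, 'n) free_alg set)"
proof
  show "coord_ideal R \<subseteq> twist ` quantum_ideal \<theta> R"
  proof
    fix f :: "('r, 'n) free_alg"
    assume "f \<in> coord_ideal R"
    then show "f \<in> twist ` quantum_ideal \<theta> R"
      using untwist_coord_ideal twist_untwist by (metis imageI)
  qed
qed (auto intro: twist_quantum_ideal)

text \<open>Cosets are sets of free algebra elements, so the induced map is simply the image under
  \<open>twist\<close>, with no choice of representatives.\<close>

lemma twist_image_coset:
  "twist ` (quantum_ideal \<theta> R +>\<^bsub>free_ring\<^esub> a) = coord_ideal R +>\<^bsub>free_ring\<^esub> twist a"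
  unfolding coset_free_ring twist_image_quantum_ideal[symmetric]
  by (simp add: image_image rescale_add)

end


section \<open>The cotwisted product\<close>

lemma quot_component_coset:
  assumes "ideal I free_ring" and "graded I"
  shows "quot_component I w (I +>\<^bsub>free_ring\<^esub> f) = I +>\<^bsub>free_ring\<^esub> component w f"
  using assms by (intro induced_coset) (auto simp: component_add graded_def)

lemma quot_scale_coset:
  assumes "ideal I free_ring"
  shows "quot_scale I c (I +>\<^bsub>free_ring\<^esub> f) = I +>\<^bsub>free_ring\<^esub> (scalar c * f)"
  using assms by (intro induced_coset) (auto simp: distrib_left ideal_mult_left)

lemma quot_star_coset:
  "quot_star (star_ideal S) (star_ideal S +>\<^bsub>free_ring\<^esub> f) = star_ideal S +>\<^bsub>free_ring\<^esub> star f"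
  by (intro induced_coset ideal_star_ideal) (auto simp: star_add star_in_star_ideal)

lemma quot_mult_coset:
  assumes "ideal I free_ring"
  shows "(I +>\<^bsub>free_ring\<^esub> f) \<otimes>\<^bsub>free_ring Quot I\<^esub> (I +>\<^bsub>free_ring\<^esub> g) = I +>\<^bsub>free_ring\<^esub> (f * g)"
  using ideal.rcoset_mult_add[OF assms, of f g] by (simp add: FactRing_def)

lemma quot_add_coset:
  assumes "ideal I free_ring"
  shows "(I +>\<^bsub>free_ring\<^esub> f) \<oplus>\<^bsub>free_ring Quot I\<^esub> (I +>\<^bsub>free_ring\<^esub> g) = I +>\<^bsub>free_ring\<^esub> (f + g)"
  using ring_hom_add[OF ideal.rcos_ring_hom[OF assms], of f g] by simp

lemma quot_zero_coset:
  assumes "ideal I free_ring"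
  shows "\<zero>\<^bsub>free_ring Quot I\<^esub> = I +>\<^bsub>free_ring\<^esub> 0"
  by (simp add: FactRing_def coset_free_ring)

lemma carrier_quot: "carrier (free_ring Quot I) = range (\<lambda>f. I +>\<^bsub>free_ring\<^esub> f)"
  by (auto simp: FactRing_def A_RCOSETS_def')

lemma finsum_coset:
  assumes I: "ideal I free_ring" and "finite A"
  shows "finsum (free_ring Quot I) (\<lambda>x. I +>\<^bsub>free_ring\<^esub> f x) A = I +>\<^bsub>free_ring\<^esub> sum f A"
proof -
  interpret Q: ring "free_ring Quot I" by (rule ideal.quotient_is_ring[OF I])
  show ?thesis
    using assms(2)
    by (induction A) (simp_all add: quot_zero_coset[OF I] quot_add_coset[OF I] carrier_quot Pi_iff)
qed

context theta_matrix
begin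

text \<open>\<open>twisted_mult\<close> sums over weights whose components survive in the quotient,
  \<open>rescale_mult\<close> over all weights of words in \<open>f\<close> and \<open>g\<close>.
  The additional terms lie in \<open>I\<close>.\<close>

lemma twisted_mult_coset:
  fixes R :: "'r mat_rel set" and f g :: "('r, 'n) free_alg"
  defines "I \<equiv> coord_ideal R"
  shows "twisted_mult \<theta> R (I +>\<^bsub>free_ring\<^esub> twist f) (I +>\<^bsub>free_ring\<^esub> twist g)
    = I +>\<^bsub>free_ring\<^esub> twist (f * g)"
proof -
  have I: "ideal I free_ring" and gr: "graded I"
    unfolding I_def by (rule ideal_coord_ideal graded_coord_ideal)+
  define V where "V = word_weight ` Poly_Mapping.keys f"
  define W where "W = word_weight ` Poly_Mapping.keys g"
  have fin: "finite V" "finite W" by (simp_all add: V_def W_def)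
  define t where "t = (\<lambda>(v, w). scalar (cocycle \<theta> v w) * (component v (twist f) * component w (twist g)))"
  have support: "support R (I +>\<^bsub>free_ring\<^esub> h) = {w. component w h \<notin> I}" for h
    by (simp add: support_def coord_alg_def quot_component_coset[OF I gr] quot_zero_coset[OF I]
        coset_eq_iff[OF I] flip: I_def)
  have component_zero: "component v (twist h) = 0" if "v \<notin> word_weight ` Poly_Mapping.keys h"
    for v and h :: "('r, 'n) free_alg"
    unfolding component_eq_rescale using that
    by (intro poly_mapping_eqI) (auto simp: in_keys_iff)
  let ?S = "support R (I +>\<^bsub>free_ring\<^esub> twist f) \<times> support R (I +>\<^bsub>free_ring\<^esub> twist g)"
  \<comment> \<open>This also makes the support finite, as is essential: over an infinite set
    \<open>finsum\<close> would default to zero.\<close>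
  have sub: "?S \<subseteq> V \<times> W"
    unfolding support V_def W_def using component_zero ideal_zero[OF I] by fastforce
  have t: "t p \<in> I" if "p \<notin> ?S" for p
  proof (cases p)
    case (Pair v w)
    have "component v (twist f) \<in> I \<or> component w (twist g) \<in> I"
      using that unfolding support Pair by blast
    then have "component v (twist f) * component w (twist g) \<in> I"
      using ideal_mult_left[OF I] ideal_mult_right[OF I] by blast
    then show ?thesis using ideal_mult_left[OF I] unfolding t_def Pair by simp
  qed
  have "twisted_mult \<theta> R (I +>\<^bsub>free_ring\<^esub> twist f) (I +>\<^bsub>free_ring\<^esub> twist g)
      = finsum (free_ring Quot I) (\<lambda>p. I +>\<^bsub>free_ring\<^esub> t p) ?S"
    unfolding twisted_mult_def coord_alg_def I_def[symmetric]
    by (rule arg_cong[where f = "\<lambda>h. finsum _ h _"])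
      (simp add: fun_eq_iff t_def quot_component_coset[OF I gr] quot_mult_coset[OF I]
        quot_scale_coset[OF I])
  also have "\<dots> = I +>\<^bsub>free_ring\<^esub> sum t ?S"
    using sub fin by (intro finsum_coset[OF I] finite_subset[OF sub]) simp
  also have "\<dots> = I +>\<^bsub>free_ring\<^esub> sum t (V \<times> W)"
  proof -
    have "sum t (V \<times> W) - sum t ?S = sum t (V \<times> W - ?S)"
      using sub fin by (simp add: sum_diff)
    also have "\<dots> \<in> I" using t by (intro ideal_sum[OF I]) auto
    finally show ?thesis using coset_eq_iff[OF I] by metis
  qed
  also have "sum t (V \<times> W) = twist (f * g)"
    unfolding t_def
    by (rule rescale_mult[OF word_phase_append, symmetric]) (simp_all add: V_def W_def)
  finally show ?thesis .
qed

lemma twist_image_ring_iso: "(`) twist \<in> ring_iso (quantum_alg \<theta> R) (cotwist_alg \<theta> R)"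
proof (rule ring_iso_memI)
  let ?Q = "quantum_ideal \<theta> R" and ?I = "coord_ideal R"
  have carrier: "carrier (quantum_alg \<theta> R) = range (\<lambda>a. ?Q +>\<^bsub>free_ring\<^esub> a)"
    "carrier (cotwist_alg \<theta> R) = range (\<lambda>a. ?I +>\<^bsub>free_ring\<^esub> a)"
    by (simp_all add: quantum_alg_def cotwist_alg_def coord_alg_def carrier_quot)
  note Q = ideal_quantum_ideal[of \<theta> R] and I = ideal_coord_ideal[of R]
  fix A B
  assume A: "A \<in> carrier (quantum_alg \<theta> R)"
  then show "twist ` A \<in> carrier (cotwist_alg \<theta> R)"
    by (auto simp: carrier twist_image_coset)
  assume "B \<in> carrier (quantum_alg \<theta> R)"
  with A obtain a b where AB: "A = ?Q +>\<^bsub>free_ring\<^esub> a" "B = ?Q +>\<^bsub>free_ring\<^esub> b"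
    by (auto simp: carrier)
  show "twist ` (A \<otimes>\<^bsub>quantum_alg \<theta> R\<^esub> B) = twist ` A \<otimes>\<^bsub>cotwist_alg \<theta> R\<^esub> twist ` B"
    unfolding AB quantum_alg_def quot_mult_coset[OF Q] twist_image_coset
    by (simp add: cotwist_alg_def twisted_mult_coset)
  show "twist ` (A \<oplus>\<^bsub>quantum_alg \<theta> R\<^esub> B) = twist ` A \<oplus>\<^bsub>cotwist_alg \<theta> R\<^esub> twist ` B"
    unfolding AB quantum_alg_def quot_add_coset[OF Q] twist_image_coset
    by (simp add: cotwist_alg_def coord_alg_def quot_add_coset[OF I] rescale_add)
next
  show "twist ` \<one>\<^bsub>quantum_alg \<theta> R\<^esub> = \<one>\<^bsub>cotwist_alg \<theta> R\<^esub>"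
    by (simp add: quantum_alg_def cotwist_alg_def coord_alg_def FactRing_def twist_image_coset
        twist_one)
next
  \<comment> \<open>Bijectivity on the whole free algebra makes the image map injective on all
    subsets, in particular on cosets.\<close>
  have inj: "inj (twist :: ('r, 'n) free_alg \<Rightarrow> _)"
    by (intro bij_is_inj bij_rescale) simp
  show "bij_betw ((`) twist) (carrier (quantum_alg \<theta> R)) (carrier (cotwist_alg \<theta> R))"
  proof (rule bij_betwI')
    fix A B :: "('r, 'n) free_alg set"
    show "(twist ` A = twist ` B) = (A = B)" by (rule inj_image_eq_iff[OF inj])
  next
    fix A assume "A \<in> carrier (quantum_alg \<theta> R)"
    then show "twist ` A \<in> carrier (cotwist_alg \<theta> R)"
      by (auto simp: quantum_alg_def cotwist_alg_def coord_alg_def carrier_quot twist_image_coset)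
  next
    fix B assume "B \<in> carrier (cotwist_alg \<theta> R)"
    then obtain b where "B = coord_ideal R +>\<^bsub>free_ring\<^esub> twist (untwist b)"
      by (auto simp: cotwist_alg_def coord_alg_def carrier_quot twist_untwist)
    then have "B = twist ` (quantum_ideal \<theta> R +>\<^bsub>free_ring\<^esub> untwist b)"
      by (simp only: twist_image_coset)
    then show "\<exists>A\<in>carrier (quantum_alg \<theta> R). B = twist ` A"
      by (auto simp: quantum_alg_def carrier_quot)
  qed
qed

end

theorem proposition6p1:
  fixes \<theta> :: "complex^'n::finite^'n" and R :: "'r::finite mat_rel set"
  assumes rows: "\<And>\<mu>. (\<Sum>\<nu>\<in>UNIV. \<theta> $ \<mu> $ \<nu>) = 0"
    and cols: "\<And>\<nu>. (\<Sum>\<mu>\<in>UNIV. \<theta> $ \<mu> $ \<nu>) = 0"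
    and antiherm: "\<And>\<mu> \<nu>. cnj (\<theta> $ \<nu> $ \<mu>) = - \<theta> $ \<mu> $ \<nu>"
  shows "\<exists>\<phi> \<in> ring_iso (quantum_alg \<theta> R) (cotwist_alg \<theta> R).
      (\<forall>c. \<forall>A \<in> carrier (quantum_alg \<theta> R).
         \<phi> (quot_scale (quantum_ideal \<theta> R) c A) = quot_scale (coord_ideal R) c (\<phi> A)) \<and>
      (\<forall>A \<in> carrier (quantum_alg \<theta> R).
         \<phi> (quot_star (quantum_ideal \<theta> R) A) = quot_star (coord_ideal R) (\<phi> A)) \<and>
      (\<forall>i \<mu> \<nu>.
         \<phi> (quantum_ideal \<theta> R +>\<^bsub>free_ring\<^esub> var (Entry i \<mu> \<nu>)) = hat_gen \<theta> R i \<mu> \<nu>)"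
proof -
  interpret theta_matrix \<theta> by unfold_locales (fact rows cols antiherm)+
  note Q = ideal_quantum_ideal[of \<theta> R] and I = ideal_coord_ideal[of R]
  show ?thesis
  proof (intro bexI[OF _ twist_image_ring_iso] conjI allI ballI)
    fix c A assume "A \<in> carrier (quantum_alg \<theta> R)"
    then obtain a where "A = quantum_ideal \<theta> R +>\<^bsub>free_ring\<^esub> a"
      by (auto simp: quantum_alg_def carrier_quot)
    then show "twist ` quot_scale (quantum_ideal \<theta> R) c A = quot_scale (coord_ideal R) c (twist ` A)"
      by (simp only: quot_scale_coset[OF Q] quot_scale_coset[OF I] twist_image_coset
          rescale_scalar_mult)
  next
    fix A assume "A \<in> carrier (quantum_alg \<theta> R)"
    then obtain a where "A = quantum_ideal \<theta> R +>\<^bsub>free_ring\<^esub> a"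
      by (auto simp: quantum_alg_def carrier_quot)
    then show "twist ` quot_star (quantum_ideal \<theta> R) A = quot_star (coord_ideal R) (twist ` A)"
      using quot_star_coset[of "commutation_elems \<theta> R \<union> rel_elems R" a, folded quantum_ideal_def]
        quot_star_coset[of "{f * g - g * f | f g. True} \<union> rel_elems R" "twist a",
          folded coord_ideal_def]
      by (simp only: twist_image_coset star_twist)
  next
    fix i \<mu> \<nu>
    \<comment> \<open>On a one-letter word the cocycle factor is 1, which leaves exactly the phase
      of the generator with a hat.\<close>
    show "twist ` (quantum_ideal \<theta> R +>\<^bsub>free_ring\<^esub> var (Entry i \<mu> \<nu>)) = hat_gen \<theta> R i \<mu> \<nu>"
      by (simp add: hat_gen_def twist_image_coset twist_var quot_scale_coset[OF I])
  qed
qed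

end
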